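(* Let $G$ be a conjugacy separable, relatively hyperbolic group, i.e. $G$ is a finitely generated conjugacy separable group which is hyperbolic relative to a family $\mathcal{G}$ of finitely generated subgroups, each of which is a proper subgroup of $G$. Then every virtually torsion-free subgroup of the outer automorphism group $\mathrm{Out}(G)=\mathrm{Aut}(G)/\mathrm{Inn}(G)$ is residually finite.
   Context: A group $G$ is conjugacy separable if for any two non-conjugate elements $x,y\in G$ there is a finite homomorphic image of $G$ in which the images of $x$ and $y$ are not conjugate. Relative hyperbolicity (Bowditch's definition, with infinite peripheral subgroups): a finitely generated group $G$ is hyperbolic relative to a family $\mathcal{G}$ of finitely generated subgroups if $G$ admits a proper, discontinuous and isometric action on a proper, (Gromov) hyperbolic path metric space $X$ such that $G$ acts on the ideal boundary $\partial X$ as a geometrically finite convergence group and the elements of $\mathcal{G}$ are the maximal parabolic subgroups of $G$. Here a convergence group action on $\partial X$ is geometrically finite if every point of $\partial X$ is either a conical limit point or a bounded parabolic point; a parabolic subgroup is an infinite subgroup that fixes a point of $\partial X$ and contains no loxodromic element; a parabolic point $p$ is bounded if its stabilizer acts cocompactly on $\partial X\setminus\{p\}$. The family $\mathcal{G}$ may be empty, in which case $G$ is a hyperbolic group. Standing convention: every relatively hyperbolic group is assumed to properly contain the corresponding maximal parabolic subgroups (this excludes the trivial situation of a group being hyperbolic relative to itself). *)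

theory Defs
  imports
    "HOL-Analysis.Analysis"
    "HOL-Algebra.Group_Action"
    "HOL-Algebra.Generated_Groups"
    "HOL-Algebra.Multiplicative_Group"
begin

section \<open>Group theory\<close>

text \<open>Finite generation of a subgroup; \<open>H = carrier G\<close> gives finite generation of the group.\<close>

definition finitely_generated_subgroup :: "('g, 'm) monoid_scheme \<Rightarrow> 'g set \<Rightarrow> bool" where
  "finitely_generated_subgroup G H \<longleftrightarrow>
     subgroup H G \<and> (\<exists>S. finite S \<and> S \<subseteq> H \<and> generate G S = H)"

definition conjugate_in :: "('g, 'm) monoid_scheme \<Rightarrow> 'g \<Rightarrow> 'g \<Rightarrow> bool" where
  "conjugate_in G x y \<longleftrightarrow> (\<exists>g \<in> carrier G. y = g \<otimes>\<^bsub>G\<^esub> x \<otimes>\<^bsub>G\<^esub> inv\<^bsub>G\<^esub> g)"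

text \<open>Every finite group is isomorphic to one whose elements are natural numbers, so letting the
  finite images range over groups of type \<^typ>\<open>nat monoid\<close> is no restriction.\<close>

definition conjugacy_separable :: "('g, 'm) monoid_scheme \<Rightarrow> bool" where
  "conjugacy_separable G \<longleftrightarrow>
     (\<forall>x \<in> carrier G. \<forall>y \<in> carrier G. \<not> conjugate_in G x y \<longrightarrow>
        (\<exists>(F :: nat monoid) f. group F \<and> finite (carrier F) \<and> f \<in> epi G F \<and>
           \<not> conjugate_in F (f x) (f y)))"

definition residually_finite :: "('g, 'm) monoid_scheme \<Rightarrow> bool" where
  "residually_finite G \<longleftrightarrow>
     (\<forall>x \<in> carrier G. x \<noteq> \<one>\<^bsub>G\<^esub> \<longrightarrow>
        (\<exists>(F :: nat monoid) f. group F \<and> finite (carrier F) \<and> f \<in> epi G F \<and> f x \<noteq> \<one>\<^bsub>F\<^esub>))"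

text \<open>In the library, \<^term>\<open>group.ord G x = 0\<close> means that \<open>x\<close> has infinite order.\<close>

definition torsion_free_subgroup :: "('g, 'm) monoid_scheme \<Rightarrow> 'g set \<Rightarrow> bool" where
  "torsion_free_subgroup G T \<longleftrightarrow>
     subgroup T G \<and> (\<forall>x \<in> T. x \<noteq> \<one>\<^bsub>G\<^esub> \<longrightarrow> group.ord G x = 0)"

definition virtually_torsion_free :: "('g, 'm) monoid_scheme \<Rightarrow> bool" where
  "virtually_torsion_free G \<longleftrightarrow>
     (\<exists>T. torsion_free_subgroup G T \<and> finite (rcosets\<^bsub>G\<^esub> T))"

definition Inn :: "('g, 'm) monoid_scheme \<Rightarrow> ('g \<Rightarrow> 'g) set" where
  "Inn G = (\<lambda>g. \<lambda>x \<in> carrier G. g \<otimes>\<^bsub>G\<^esub> x \<otimes>\<^bsub>G\<^esub> inv\<^bsub>G\<^esub> g) ` carrier G"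

definition Out :: "('g, 'm) monoid_scheme \<Rightarrow> ('g \<Rightarrow> 'g) set monoid" where
  "Out G = AutoGroup G Mod Inn G"

lemma (in group) conjugation_in_auto:
  assumes g: "g \<in> carrier G"
  shows "(\<lambda>x \<in> carrier G. g \<otimes> x \<otimes> inv g) \<in> auto G"
proof -
  have c1: "inv g \<otimes> (g \<otimes> x) = x" if "x \<in> carrier G" for x
    using g that by (simp flip: m_assoc)
  have c2: "g \<otimes> (inv g \<otimes> x) = x" if "x \<in> carrier G" for x
    using g that by (simp flip: m_assoc)
  have "bij_betw (\<lambda>x \<in> carrier G. g \<otimes> x \<otimes> inv g) (carrier G) (carrier G)"
    by (rule bij_betw_byWitness[where f' = "\<lambda>x. inv g \<otimes> x \<otimes> g"])
       (use g c1 c2 in \<open>auto simp: m_assoc\<close>)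
  moreover have "(\<lambda>x \<in> carrier G. g \<otimes> x \<otimes> inv g) \<in> hom G G"
    using g c1 by (auto simp: hom_def m_assoc)
  ultimately show ?thesis
    by (simp add: auto_def Bij_def)
qed

lemma (in group) Inn_normal: "Inn G \<lhd> AutoGroup G"
proof -
  interpret A: group "AutoGroup G" by (rule AutoGroup)
  define c where "c = (\<lambda>g. \<lambda>x \<in> carrier G. g \<otimes> x \<otimes> inv g)"
  have c_auto: "c g \<in> auto G" if "g \<in> carrier G" for g
    using conjugation_in_auto[OF that] by (simp add: c_def)
  have auto_Bij: "f \<in> Bij (carrier G)" if "f \<in> auto G" for f
    using that by (simp add: auto_def)
  have carr: "carrier (AutoGroup G) = auto G"
    by (simp add: AutoGroup_def)
  have mult: "f \<otimes>\<^bsub>AutoGroup G\<^esub> h = compose (carrier G) f h"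
    if "f \<in> auto G" "h \<in> auto G" for f h
    using that auto_Bij by (simp add: AutoGroup_def BijGroup_def)
  have c_hom: "c \<in> hom G (AutoGroup G)"
  proof (rule homI)
    show "c g \<in> carrier (AutoGroup G)" if "g \<in> carrier G" for g
      using c_auto[OF that] by (simp add: carr)
    show "c (g \<otimes> h) = c g \<otimes>\<^bsub>AutoGroup G\<^esub> c h"
      if "g \<in> carrier G" "h \<in> carrier G" for g h
      unfolding mult[OF c_auto[OF that(1)] c_auto[OF that(2)]]
      using that by (auto simp: c_def compose_def fun_eq_iff m_assoc inv_mult_group)
  qed
  interpret c: group_hom G "AutoGroup G" c
    by unfold_locales (rule c_hom)
  have Inn: "Inn G = c ` carrier G"
    by (simp add: Inn_def c_def)
  have sub: "subgroup (Inn G) (AutoGroup G)"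
    unfolding Inn by (rule c.img_is_subgroup)
  show ?thesis
    unfolding A.normal_inv_iff
  proof (intro conjI ballI sub)
    fix f k
    assume f: "f \<in> carrier (AutoGroup G)" and "k \<in> Inn G"
    then obtain g where g: "g \<in> carrier G" and k: "k = c g"
      by (auto simp: Inn)
    have fa: "f \<in> auto G" using f by (simp add: carr)
    have f_hom: "f \<in> hom G G" using fa by (simp add: auto_def)
    then interpret f: group_hom G G f by unfold_locales
    have fg: "f g \<in> carrier G" using g by simp
    have "f \<otimes>\<^bsub>AutoGroup G\<^esub> c g = c (f g) \<otimes>\<^bsub>AutoGroup G\<^esub> f"
      unfolding mult[OF fa c_auto[OF g]] mult[OF c_auto[OF fg] fa]
      using g by (auto simp: c_def compose_def fun_eq_iff)
    then have "f \<otimes>\<^bsub>AutoGroup G\<^esub> k \<otimes>\<^bsub>AutoGroup G\<^esub> inv\<^bsub>AutoGroup G\<^esub> f = c (f g)"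
      using f c.hom_closed[OF fg] by (simp add: k A.m_assoc)
    then show "f \<otimes>\<^bsub>AutoGroup G\<^esub> k \<otimes>\<^bsub>AutoGroup G\<^esub> inv\<^bsub>AutoGroup G\<^esub> f \<in> Inn G"
      using fg by (simp add: Inn)
  qed
qed

lemma (in group) group_Out: "group (Out G)"
  unfolding Out_def by (rule normal.factorgroup_is_group[OF Inn_normal])


section \<open>Proper hyperbolic path metric spaces\<close>

definition proper_metric_space :: "'a metric \<Rightarrow> bool" where
  "proper_metric_space X \<longleftrightarrow>
     (\<forall>x \<in> mspace X. \<forall>r. compactin (mtopology_of X) (mcball_of X x r))"

text \<open>Length of a path parametrized by \<open>[0,1]\<close>: the supremum of the lengths of the polygons
  inscribed along subdivisions \<open>t 0 \<le> \<dots> \<le> t n\<close> of \<open>[0,1]\<close>.\<close>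

definition path_len :: "'a metric \<Rightarrow> (real \<Rightarrow> 'a) \<Rightarrow> ereal" where
  "path_len X \<gamma> =
     (SUP (n, t) \<in> {(n :: nat, t :: nat \<Rightarrow> real). mono_on {..n} t \<and> t ` {..n} \<subseteq> {0..1}}.
        ereal (\<Sum>i<n. mdist X (\<gamma> (t i)) (\<gamma> (t (Suc i)))))"

definition path_metric_space :: "'a metric \<Rightarrow> bool" where
  "path_metric_space X \<longleftrightarrow>
     (\<forall>x \<in> mspace X. \<forall>y \<in> mspace X.
        ereal (mdist X x y) =
          (INF \<gamma> \<in> {\<gamma>. pathin (mtopology_of X) \<gamma> \<and> \<gamma> 0 = x \<and> \<gamma> 1 = y}. path_len X \<gamma>))"

definition gromov_product :: "'a metric \<Rightarrow> 'a \<Rightarrow> 'a \<Rightarrow> 'a \<Rightarrow> real" where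
  "gromov_product X w x y = (mdist X x w + mdist X y w - mdist X x y) / 2"

definition gromov_hyperbolic :: "'a metric \<Rightarrow> bool" where
  "gromov_hyperbolic X \<longleftrightarrow>
     (\<exists>\<delta>. \<forall>w \<in> mspace X. \<forall>x \<in> mspace X. \<forall>y \<in> mspace X. \<forall>z \<in> mspace X.
        gromov_product X w x z \<ge> min (gromov_product X w x y) (gromov_product X w y z) - \<delta>)"


section \<open>The ideal boundary\<close>

text \<open>Boundary points are equivalence classes of sequences converging at infinity. Changing the
  base point \<open>w\<close> alters Gromov products by a bounded amount, so quantifying over all base
  points is the same as fixing one.\<close>

definition gromov_asymptotic :: "'a metric \<Rightarrow> (nat \<Rightarrow> 'a) \<Rightarrow> (nat \<Rightarrow> 'a) \<Rightarrow> bool" where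
  "gromov_asymptotic X x y \<longleftrightarrow>
     (\<forall>w \<in> mspace X.
        filterlim (\<lambda>(i, j). gromov_product X w (x i) (y j)) at_top (sequentially \<times>\<^sub>F sequentially))"

definition gromov_sequences :: "'a metric \<Rightarrow> (nat \<Rightarrow> 'a) set" where
  "gromov_sequences X = {x. range x \<subseteq> mspace X \<and> gromov_asymptotic X x x}"

definition ideal_boundary :: "'a metric \<Rightarrow> (nat \<Rightarrow> 'a) set set" where
  "ideal_boundary X =
     gromov_sequences X //
       {(x, y). x \<in> gromov_sequences X \<and> y \<in> gromov_sequences X \<and> gromov_asymptotic X x y}"

definition boundary_product ::
    "'a metric \<Rightarrow> 'a \<Rightarrow> (nat \<Rightarrow> 'a) set \<Rightarrow> (nat \<Rightarrow> 'a) set \<Rightarrow> ereal" where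
  "boundary_product X w \<xi> \<eta> =
     (SUP (x, y) \<in> \<xi> \<times> \<eta>.
        Liminf (sequentially \<times>\<^sub>F sequentially) (\<lambda>(i, j). ereal (gromov_product X w (x i) (y j))))"

text \<open>The usual topology: the sets \<open>{\<eta>. (\<xi>|\<eta>)\<^sub>w > r}\<close> form a neighbourhood
  base at \<open>\<xi>\<close> (they need not be open themselves).\<close>

definition boundary_topology :: "'a metric \<Rightarrow> (nat \<Rightarrow> 'a) set topology" where
  "boundary_topology X = topology (\<lambda>U. U \<subseteq> ideal_boundary X \<and>
     (\<forall>\<xi> \<in> U. \<forall>w \<in> mspace X. \<exists>r :: real.
        {\<eta> \<in> ideal_boundary X. boundary_product X w \<xi> \<eta> > ereal r} \<subseteq> U))"

lemma openin_boundary_topology: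
  "openin (boundary_topology X) U \<longleftrightarrow> U \<subseteq> ideal_boundary X \<and>
     (\<forall>\<xi> \<in> U. \<forall>w \<in> mspace X. \<exists>r :: real.
        {\<eta> \<in> ideal_boundary X. boundary_product X w \<xi> \<eta> > ereal r} \<subseteq> U)"
proof -
  let ?N = "\<lambda>w \<xi> r. {\<eta> \<in> ideal_boundary X. boundary_product X w \<xi> \<eta> > ereal r}"
  let ?P = "\<lambda>U. U \<subseteq> ideal_boundary X \<and> (\<forall>\<xi> \<in> U. \<forall>w \<in> mspace X. \<exists>r :: real. ?N w \<xi> r \<subseteq> U)"
  have "istopology ?P"
    unfolding istopology_def
  proof (intro conjI allI impI)
    fix S T assume S: "?P S" and T: "?P T"
    show "S \<inter> T \<subseteq> ideal_boundary X" using S by blast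
    show "\<forall>\<xi> \<in> S \<inter> T. \<forall>w \<in> mspace X. \<exists>r. ?N w \<xi> r \<subseteq> S \<inter> T"
    proof (intro ballI)
      fix \<xi> w assume "\<xi> \<in> S \<inter> T" "w \<in> mspace X"
      then obtain r s where "?N w \<xi> r \<subseteq> S" "?N w \<xi> s \<subseteq> T" using S T by blast
      moreover have "?N w \<xi> (max r s) \<subseteq> ?N w \<xi> r \<inter> ?N w \<xi> s"
        by (auto intro: le_less_trans[rotated])
      ultimately show "\<exists>r. ?N w \<xi> r \<subseteq> S \<inter> T" by blast
    qed
  next
    fix \<K> assume K: "\<forall>K \<in> \<K>. ?P K"
    show "\<Union>\<K> \<subseteq> ideal_boundary X" using K by blast
    show "\<forall>\<xi> \<in> \<Union>\<K>. \<forall>w \<in> mspace X. \<exists>r. ?N w \<xi> r \<subseteq> \<Union>\<K>"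
    proof (intro ballI)
      fix \<xi> w assume "\<xi> \<in> \<Union>\<K>" "w \<in> mspace X"
      then obtain K where KK: "K \<in> \<K>" "\<xi> \<in> K" by blast
      then obtain r where "?N w \<xi> r \<subseteq> K" using K \<open>w \<in> mspace X\<close> by blast
      with KK show "\<exists>r. ?N w \<xi> r \<subseteq> \<Union>\<K>" by blast
    qed
  qed
  then show ?thesis by (simp add: boundary_topology_def)
qed

lemma topspace_boundary_topology [simp]: "topspace (boundary_topology X) = ideal_boundary X"
proof
  show "topspace (boundary_topology X) \<subseteq> ideal_boundary X"
    using openin_topspace[of "boundary_topology X"] unfolding openin_boundary_topology by blast
  have "openin (boundary_topology X) (ideal_boundary X)"
    by (auto simp: openin_boundary_topology)
  then show "ideal_boundary X \<subseteq> topspace (boundary_topology X)"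
    by (rule openin_subset)
qed

definition boundary_action ::
    "'a metric \<Rightarrow> ('g \<Rightarrow> 'a \<Rightarrow> 'a) \<Rightarrow> 'g \<Rightarrow> (nat \<Rightarrow> 'a) set \<Rightarrow> (nat \<Rightarrow> 'a) set" where
  "boundary_action X \<phi> g = (\<lambda>\<xi> \<in> ideal_boundary X. (\<lambda>x. \<phi> g \<circ> x) ` \<xi>)"

text \<open>The boundary action is an action on the boundary in the sense of the library.\<close>

lemma group_action_boundary_action:
  assumes act: "group_action G (mspace X) \<phi>"
    and iso: "\<And>g x y. g \<in> carrier G \<Longrightarrow> x \<in> mspace X \<Longrightarrow> y \<in> mspace X \<Longrightarrow>
                mdist X (\<phi> g x) (\<phi> g y) = mdist X x y"
  shows "group_action G (ideal_boundary X) (boundary_action X \<phi>)"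
proof -
  interpret \<phi>: group_action G "mspace X" \<phi> by (rule act)
  interpret G: group G using \<phi>.group_hom by (rule group_hom.axioms)
  let ?S = "gromov_sequences X" and ?B = "ideal_boundary X"
  let ?R = "{(x, y). x \<in> ?S \<and> y \<in> ?S \<and> gromov_asymptotic X x y}"
  let ?a = "\<lambda>g. (\<lambda>x. \<phi> g \<circ> x)"
  have mem: "\<phi> g x \<in> mspace X" if "g \<in> carrier G" "x \<in> mspace X" for g x
    using that by (rule \<phi>.element_image) simp
  have inv1: "\<phi> (inv\<^bsub>G\<^esub> g) (\<phi> g x) = x" if "g \<in> carrier G" "x \<in> mspace X" for g x
    using \<phi>.orbit_sym_aux[OF that refl] .
  have inv2: "\<phi> g (\<phi> (inv\<^bsub>G\<^esub> g) x) = x" if "g \<in> carrier G" "x \<in> mspace X" for g x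
    using inv1[of "inv\<^bsub>G\<^esub> g" x] that by simp
  have asym: "gromov_asymptotic X (?a g x) (?a g y)"
    if g: "g \<in> carrier G" and x: "range x \<subseteq> mspace X" and y: "range y \<subseteq> mspace X"
      and xy: "gromov_asymptotic X x y" for g x y
    unfolding gromov_asymptotic_def
  proof
    fix w assume w: "w \<in> mspace X"
    have d: "mdist X (\<phi> g u) w = mdist X u (\<phi> (inv\<^bsub>G\<^esub> g) w)" if "u \<in> mspace X" for u
      using iso[OF g that, of "\<phi> (inv\<^bsub>G\<^esub> g) w"] mem[of "inv\<^bsub>G\<^esub> g" w] inv2[OF g w] g w by simp
    have "gromov_product X w ((?a g x) i) ((?a g y) j) =
          gromov_product X (\<phi> (inv\<^bsub>G\<^esub> g) w) (x i) (y j)" for i j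
    proof -
      have "x i \<in> mspace X" "y j \<in> mspace X" using x y by auto
      then show ?thesis using iso[OF g, of "x i" "y j"] d by (simp add: gromov_product_def)
    qed
    moreover have "\<phi> (inv\<^bsub>G\<^esub> g) w \<in> mspace X" using mem[OF G.inv_closed[OF g] w] .
    ultimately show "filterlim (\<lambda>(i, j). gromov_product X w ((?a g x) i) ((?a g y) j)) at_top
        (sequentially \<times>\<^sub>F sequentially)"
      using xy by (simp only: gromov_asymptotic_def)
  qed
  have seq: "?a g x \<in> ?S" if "g \<in> carrier G" "x \<in> ?S" for g x
    using that asym[of g x x] mem by (auto simp: gromov_sequences_def)
  have cancel: "?a (inv\<^bsub>G\<^esub> g) (?a g x) = x" "?a g (?a (inv\<^bsub>G\<^esub> g) x) = x"
    if "g \<in> carrier G" "x \<in> ?S" for g x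
    using that inv1 inv2 by (auto simp: gromov_sequences_def fun_eq_iff image_subset_iff)
  have rel: "(?a g x, ?a g y) \<in> ?R" if "g \<in> carrier G" "(x, y) \<in> ?R" for g x y
    using that asym[of g x y] seq by (auto simp: gromov_sequences_def)
  have cls: "?a g ` (?R `` {x}) = ?R `` {?a g x}" if g: "g \<in> carrier G" and x: "x \<in> ?S" for g x
  proof
    show "?a g ` (?R `` {x}) \<subseteq> ?R `` {?a g x}" using rel[OF g] by blast
    show "?R `` {?a g x} \<subseteq> ?a g ` (?R `` {x})"
    proof
      fix z assume z: "z \<in> ?R `` {?a g x}"
      then have zS: "z \<in> ?S" by blast
      have "(?a (inv\<^bsub>G\<^esub> g) (?a g x), ?a (inv\<^bsub>G\<^esub> g) z) \<in> ?R"
        using rel[of "inv\<^bsub>G\<^esub> g" "?a g x" z] g z by blast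
      then have "?a (inv\<^bsub>G\<^esub> g) z \<in> ?R `` {x}" using cancel(1)[OF g x] by simp
      then show "z \<in> ?a g ` (?R `` {x})" by (rule image_eqI[where f = "?a g", OF cancel(2)[OF g zS, symmetric]])
    qed
  qed
  have bd: "?a g ` \<xi> \<in> ?B" if g: "g \<in> carrier G" and \<xi>: "\<xi> \<in> ?B" for g \<xi>
  proof -
    obtain x where x: "x \<in> ?S" "\<xi> = ?R `` {x}"
      using \<xi> unfolding ideal_boundary_def by (rule quotientE)
    show ?thesis
      unfolding x(2) cls[OF g x(1)] ideal_boundary_def by (rule quotientI) (rule seq[OF g x(1)])
  qed
  have subS: "\<xi> \<subseteq> ?S" if "\<xi> \<in> ?B" for \<xi>
    using that by (auto simp: ideal_boundary_def quotient_def)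
  have cancel_set: "?a (inv\<^bsub>G\<^esub> g) ` ?a g ` \<xi> = \<xi>" "?a g ` ?a (inv\<^bsub>G\<^esub> g) ` \<xi> = \<xi>"
    if "g \<in> carrier G" "\<xi> \<in> ?B" for g \<xi>
  proof -
    have S: "x \<in> ?S" if "x \<in> \<xi>" for x using subS[OF \<open>\<xi> \<in> ?B\<close>] that by blast
    have "?a (inv\<^bsub>G\<^esub> g) ` ?a g ` \<xi> = (\<lambda>x. x) ` \<xi>"
      unfolding image_image by (rule image_cong[OF refl]) (rule cancel(1)[OF that(1) S])
    then show "?a (inv\<^bsub>G\<^esub> g) ` ?a g ` \<xi> = \<xi>" by simp
    have "?a g ` ?a (inv\<^bsub>G\<^esub> g) ` \<xi> = (\<lambda>x. x) ` \<xi>"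
      unfolding image_image by (rule image_cong[OF refl]) (rule cancel(2)[OF that(1) S])
    then show "?a g ` ?a (inv\<^bsub>G\<^esub> g) ` \<xi> = \<xi>" by simp
  qed
  have Bij: "boundary_action X \<phi> g \<in> Bij ?B" if g: "g \<in> carrier G" for g
  proof -
    have "bij_betw (boundary_action X \<phi> g) ?B ?B"
    proof (rule bij_betw_byWitness[where f' = "\<lambda>\<xi>. ?a (inv\<^bsub>G\<^esub> g) ` \<xi>"])
      show "\<forall>\<xi> \<in> ?B. ?a (inv\<^bsub>G\<^esub> g) ` boundary_action X \<phi> g \<xi> = \<xi>"
        using cancel_set(1)[OF g] by (simp add: boundary_action_def)
      show "\<forall>\<xi> \<in> ?B. boundary_action X \<phi> g (?a (inv\<^bsub>G\<^esub> g) ` \<xi>) = \<xi>"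
        using cancel_set(2)[OF g] bd[of "inv\<^bsub>G\<^esub> g"] g by (simp add: boundary_action_def)
      show "boundary_action X \<phi> g ` ?B \<subseteq> ?B"
        using bd[OF g] by (auto simp: boundary_action_def)
      show "(\<lambda>\<xi>. ?a (inv\<^bsub>G\<^esub> g) ` \<xi>) ` ?B \<subseteq> ?B"
        using bd[of "inv\<^bsub>G\<^esub> g"] g by auto
    qed
    then show ?thesis by (simp add: Bij_def boundary_action_def)
  qed
  have comp: "boundary_action X \<phi> (g \<otimes>\<^bsub>G\<^esub> k) =
      compose ?B (boundary_action X \<phi> g) (boundary_action X \<phi> k)"
    if g: "g \<in> carrier G" and k: "k \<in> carrier G" for g k
  proof
    fix \<xi>
    have "?a (g \<otimes>\<^bsub>G\<^esub> k) ` \<xi> = ?a g ` ?a k ` \<xi>" if "\<xi> \<in> ?B"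
      unfolding image_image using subS[OF that] \<phi>.composition_rule[OF _ g k]
      by (intro image_cong refl) (auto simp: fun_eq_iff gromov_sequences_def image_subset_iff)
    then show "boundary_action X \<phi> (g \<otimes>\<^bsub>G\<^esub> k) \<xi> =
        compose ?B (boundary_action X \<phi> g) (boundary_action X \<phi> k) \<xi>"
      using bd[OF k] by (cases "\<xi> \<in> ?B") (simp_all add: boundary_action_def compose_def)
  qed
  have "boundary_action X \<phi> \<in> hom G (BijGroup ?B)"
    by (rule homI) (simp_all add: BijGroup_def Bij comp)
  then show ?thesis
    by (simp add: group_action_def group_hom_def group_hom_axioms_def group_BijGroup)
qed



section \<open>Convergence groups and geometrical finiteness\<close>

text \<open>\<open>\<psi>\<close> is an action of \<open>G\<close> by homeomorphisms of the space \<open>M\<close>, and the induced action on the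
  space of distinct triples is properly discontinuous.\<close>

definition convergence_group ::
    "('g, 'm) monoid_scheme \<Rightarrow> 'p topology \<Rightarrow> ('g \<Rightarrow> 'p \<Rightarrow> 'p) \<Rightarrow> bool" where
  "convergence_group G M \<psi> \<longleftrightarrow>
     group_action G (topspace M) \<psi> \<and>
     (\<forall>g \<in> carrier G. homeomorphic_map M M (\<psi> g)) \<and>
     (\<forall>K. compactin (prod_topology M (prod_topology M M)) K \<and>
          K \<subseteq> {(a, b, c). a \<noteq> b \<and> b \<noteq> c \<and> a \<noteq> c} \<longrightarrow>
          finite {g \<in> carrier G. (\<lambda>(a, b, c). (\<psi> g a, \<psi> g b, \<psi> g c)) ` K \<inter> K \<noteq> {}})"

definition conical_limit_point ::
    "('g, 'm) monoid_scheme \<Rightarrow> 'p topology \<Rightarrow> ('g \<Rightarrow> 'p \<Rightarrow> 'p) \<Rightarrow> 'p \<Rightarrow> bool" where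
  "conical_limit_point G M \<psi> p \<longleftrightarrow>
     p \<in> topspace M \<and>
     (\<exists>(g :: nat \<Rightarrow> 'g) a b. inj g \<and> range g \<subseteq> carrier G \<and>
        a \<in> topspace M \<and> b \<in> topspace M \<and> a \<noteq> b \<and>
        limitin M (\<lambda>n. \<psi> (g n) p) a sequentially \<and>
        (\<forall>q \<in> topspace M - {p}. limitin M (\<lambda>n. \<psi> (g n) q) b sequentially))"

text \<open>Loxodromic elements of a convergence group: infinite order and exactly two fixed points.\<close>

definition loxodromic ::
    "('g, 'm) monoid_scheme \<Rightarrow> 'p topology \<Rightarrow> ('g \<Rightarrow> 'p \<Rightarrow> 'p) \<Rightarrow> 'g \<Rightarrow> bool" where
  "loxodromic G M \<psi> g \<longleftrightarrow>
     g \<in> carrier G \<and> group.ord G g = 0 \<and> card (invariants (topspace M) \<psi> g) = 2"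

definition parabolic_fixing ::
    "('g, 'm) monoid_scheme \<Rightarrow> 'p topology \<Rightarrow> ('g \<Rightarrow> 'p \<Rightarrow> 'p) \<Rightarrow> 'g set \<Rightarrow> 'p \<Rightarrow> bool" where
  "parabolic_fixing G M \<psi> P p \<longleftrightarrow>
     subgroup P G \<and> infinite P \<and> p \<in> topspace M \<and> P \<subseteq> stabilizer G \<psi> p \<and>
     (\<forall>g \<in> P. \<not> loxodromic G M \<psi> g)"

definition parabolic_subgroup ::
    "('g, 'm) monoid_scheme \<Rightarrow> 'p topology \<Rightarrow> ('g \<Rightarrow> 'p \<Rightarrow> 'p) \<Rightarrow> 'g set \<Rightarrow> bool" where
  "parabolic_subgroup G M \<psi> P \<longleftrightarrow> (\<exists>p. parabolic_fixing G M \<psi> P p)"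

definition maximal_parabolic_subgroup ::
    "('g, 'm) monoid_scheme \<Rightarrow> 'p topology \<Rightarrow> ('g \<Rightarrow> 'p \<Rightarrow> 'p) \<Rightarrow> 'g set \<Rightarrow> bool" where
  "maximal_parabolic_subgroup G M \<psi> P \<longleftrightarrow>
     parabolic_subgroup G M \<psi> P \<and> (\<forall>Q. parabolic_subgroup G M \<psi> Q \<and> P \<subseteq> Q \<longrightarrow> Q = P)"

definition parabolic_point ::
    "('g, 'm) monoid_scheme \<Rightarrow> 'p topology \<Rightarrow> ('g \<Rightarrow> 'p \<Rightarrow> 'p) \<Rightarrow> 'p \<Rightarrow> bool" where
  "parabolic_point G M \<psi> p \<longleftrightarrow> (\<exists>P. parabolic_fixing G M \<psi> P p)"

definition bounded_parabolic_point ::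
    "('g, 'm) monoid_scheme \<Rightarrow> 'p topology \<Rightarrow> ('g \<Rightarrow> 'p \<Rightarrow> 'p) \<Rightarrow> 'p \<Rightarrow> bool" where
  "bounded_parabolic_point G M \<psi> p \<longleftrightarrow>
     parabolic_point G M \<psi> p \<and>
     (\<exists>K. compactin M K \<and> K \<subseteq> topspace M - {p} \<and>
          topspace M - {p} \<subseteq> (\<Union>g \<in> stabilizer G \<psi> p. \<psi> g ` K))"

definition geometrically_finite ::
    "('g, 'm) monoid_scheme \<Rightarrow> 'p topology \<Rightarrow> ('g \<Rightarrow> 'p \<Rightarrow> 'p) \<Rightarrow> bool" where
  "geometrically_finite G M \<psi> \<longleftrightarrow>
     convergence_group G M \<psi> \<and>
     (\<forall>p \<in> topspace M. conical_limit_point G M \<psi> p \<or> bounded_parabolic_point G M \<psi> p)"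


section \<open>Relative hyperbolicity\<close>

definition properly_discontinuous_isometric_action ::
    "('g, 'm) monoid_scheme \<Rightarrow> 'x metric \<Rightarrow> ('g \<Rightarrow> 'x \<Rightarrow> 'x) \<Rightarrow> bool" where
  "properly_discontinuous_isometric_action G X \<phi> \<longleftrightarrow>
     group_action G (mspace X) \<phi> \<and>
     (\<forall>g \<in> carrier G. \<forall>x \<in> mspace X. \<forall>y \<in> mspace X.
        mdist X (\<phi> g x) (\<phi> g y) = mdist X x y) \<and>
     (\<forall>K. compactin (mtopology_of X) K \<longrightarrow> finite {g \<in> carrier G. \<phi> g ` K \<inter> K \<noteq> {}})"

text \<open>The type argument is the type in which the points of the space \<open>X\<close> live. HOL
  cannot quantify over it inside the definition, so a hypothesis of relative hyperbolicity is to be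
  stated with a type variable. The family \<open>\<G>\<close> consists of all the maximal parabolic
  subgroups, so it is closed under conjugation. The empty space is excluded, as every group acts
  on it.\<close>

definition relatively_hyperbolic ::
    "'x itself \<Rightarrow> ('g, 'm) monoid_scheme \<Rightarrow> 'g set set \<Rightarrow> bool" where
  "relatively_hyperbolic _ G \<G> \<longleftrightarrow>
     group G \<and> finitely_generated_subgroup G (carrier G) \<and>
     (\<forall>P \<in> \<G>. finitely_generated_subgroup G P) \<and>
     (\<exists>(X :: 'x metric) \<phi>.
        mspace X \<noteq> {} \<and> proper_metric_space X \<and> path_metric_space X \<and> gromov_hyperbolic X \<and>
        properly_discontinuous_isometric_action G X \<phi> \<and>
        geometrically_finite G (boundary_topology X) (boundary_action X \<phi>) \<and>
        \<G> = {P. maximal_parabolic_subgroup G (boundary_topology X) (boundary_action X \<phi>) P})"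

end

theory Submission
  imports Defs "HOL-Library.Diagonal_Subsequence"
begin

text \<open>The group \<open>Out G\<close> acts on the finite sets \<open>Hom(G, F)\<close> with \<open>F\<close> finite, up to inner
  automorphisms of \<open>G\<close>. Conjugacy separability says that this detects every class of
  automorphisms moving some conjugacy class of \<open>G\<close> (\<open>Out_detects_class_change\<close>, an idea of
  Grossman). What remains are the classes of pointwise inner automorphisms, those mapping
  every element to a conjugate. Hyperbolicity shows that they are torsion in \<open>Out G\<close>. A
  torsion-free subgroup \<open>T\<close> of finite index in \<open>H\<close> then contains no nontrivial class of this
  kind, so the permutations of the cosets of \<open>T\<close> detect them (\<open>torsion_element_detected\<close>).

  To see that a pointwise inner \<open>\<alpha>\<close> has an inner power, let \<open>G\<close> act on the hyperbolic space,
  and let \<open>S\<close> be a finite generating set that contains an element \<open>g\<close> whose orbit does not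
  backtrack. For every \<open>n\<close> the elements \<open>\<alpha>\<^sup>n(s)\<close> and \<open>\<alpha>\<^sup>n(s t)\<close>, with \<open>s\<close> and \<open>t\<close> in \<open>S\<close>, are
  conjugate to \<open>s\<close> and \<open>s t\<close>; so each of them moves some point by an amount that is bounded
  independently of \<open>n\<close>. By a coarse form of Serre's lemma on groups acting on trees
  (\<open>almost_fixed_point\<close>) the whole set \<open>\<alpha>\<^sup>n(S)\<close> moves a common point \<open>x\<^sub>n\<close> by a bounded
  amount. This replaces the limiting action on a real tree in the method of Bestvina and
  Paulin. Write \<open>\<alpha>\<^sup>n(g) = h g h\<inverse>\<close>. Then \<open>g\<close> moves \<open>h\<inverse> x\<^sub>n\<close> by a bounded amount, and all such
  points are close to one orbit of the cyclic group of \<open>g\<close> (\<open>not_backtracks_near_orbit\<close>).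
  Hence, after composition of \<open>\<alpha>\<^sup>n\<close> with an inner automorphism, the point \<open>x\<^sub>n\<close> lies within a
  fixed distance of a base point. Now the images of the generators range over a finite set,
  because the action is proper, and two powers of \<open>\<alpha>\<close> differ by an inner automorphism.

  The element \<open>g\<close> exists when \<open>G\<close> is infinite (\<open>exists_not_backtracking\<close>): suppose that
  every element backtracks. Then Serre's lemma applies with a uniform constant to an exhaustion of
  \<open>G\<close> by finite sets. The almost fixed points escape to infinity and accumulate at a point of
  the ideal boundary that all of \<open>G\<close> fixes. Moreover no element is loxodromic, since a
  loxodromic element has a power that advances along the line between the two fixed points.
  Thus \<open>G\<close> would be a maximal parabolic subgroup, which the hypothesis on the peripheral
  family excludes. When \<open>G\<close> is finite, every automorphism has finite order.\<close>

section \<open>Finite quotients from congruences\<close>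

text \<open>Such a map induces a group structure on its image. It need not be a homomorphism into a
  given group: it may reverse products, as precomposition does, or take sets as values.\<close>

definition congruence_map :: "('a, 'm) monoid_scheme \<Rightarrow> ('a \<Rightarrow> 'b) \<Rightarrow> bool" where
  "congruence_map K \<tau> \<longleftrightarrow>
     (\<forall>x\<in>carrier K. \<forall>x'\<in>carrier K. \<forall>y\<in>carrier K. \<forall>y'\<in>carrier K.
        \<tau> x = \<tau> x' \<longrightarrow> \<tau> y = \<tau> y' \<longrightarrow> \<tau> (x \<otimes>\<^bsub>K\<^esub> y) = \<tau> (x' \<otimes>\<^bsub>K\<^esub> y'))"

text \<open>The finite group is the image of \<open>\<tau>\<close> with the induced multiplication, transported to natural
  numbers by an injection of the image.\<close>

lemma (in group) finite_image_of_congruence_map: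
  assumes fin: "finite (\<tau> ` carrier G)" and cong: "congruence_map G \<tau>"
    and h: "h \<in> carrier G" "\<tau> h \<noteq> \<tau> \<one>"
  shows "\<exists>(F :: nat monoid) f. group F \<and> finite (carrier F) \<and> f \<in> epi G F \<and> f h \<noteq> \<one>\<^bsub>F\<^esub>"
proof -
  obtain e :: "_ \<Rightarrow> nat" where e: "inj_on e (\<tau> ` carrier G)"
    using finite_imp_inj_to_nat_seg[OF fin] by blast
  define f where "f = (\<lambda>x. e (\<tau> x))"
  have f_eq: "f x = f y \<longleftrightarrow> \<tau> x = \<tau> y" if "x \<in> carrier G" "y \<in> carrier G" for x y
    using that e by (auto simp: f_def inj_on_eq_iff)
  define s where "s = inv_into (carrier G) f"
  have s: "s (f x) \<in> carrier G" "f (s (f x)) = f x" if "x \<in> carrier G" for x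
    using that by (simp_all add: s_def inv_into_into f_inv_into_f)
  define F where "F = \<lparr>carrier = f ` carrier G, mult = (\<lambda>a b. f (s a \<otimes> s b)), one = f \<one>\<rparr>"
  have mult: "f x \<otimes>\<^bsub>F\<^esub> f y = f (x \<otimes> y)" if "x \<in> carrier G" "y \<in> carrier G" for x y
  proof -
    have "\<tau> (s (f x)) = \<tau> x" "\<tau> (s (f y)) = \<tau> y"
      using that s by (simp_all flip: f_eq)
    then have "\<tau> (s (f x) \<otimes> s (f y)) = \<tau> (x \<otimes> y)"
      using cong s(1) that unfolding congruence_map_def by blast
    then show ?thesis by (simp add: F_def f_def)
  qed
  have carr: "carrier F = f ` carrier G" and one: "\<one>\<^bsub>F\<^esub> = f \<one>" by (simp_all add: F_def)
  have "group F"
  proof (rule groupI)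
    fix a assume "a \<in> carrier F"
    then obtain x where "x \<in> carrier G" "a = f x" by (auto simp: carr)
    then show "\<exists>b\<in>carrier F. b \<otimes>\<^bsub>F\<^esub> a = \<one>\<^bsub>F\<^esub>"
      by (intro bexI[of _ "f (inv x)"]) (auto simp: carr one mult)
  qed (auto simp: carr one mult m_assoc)
  moreover have "finite (carrier F)" using fin by (simp add: carr f_def flip: image_image)
  moreover have "f \<in> epi G F" by (auto simp: epi_def hom_def carr mult)
  moreover have "f h \<noteq> \<one>\<^bsub>F\<^esub>" using f_eq h by (simp add: one)
  ultimately show ?thesis by blast
qed

lemma congruence_map_subgroup:
  assumes "subgroup H K" "congruence_map K \<tau>"
  shows "congruence_map (K\<lparr>carrier := H\<rparr>) \<tau>"
  using assms subgroup.subset[OF assms(1)] unfolding congruence_map_def by (simp add: subset_iff)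

text \<open>A nontrivial torsion element lies outside \<open>T\<close>, so right translation by it moves the coset
  \<open>T\<close>.\<close>

lemma (in group) torsion_element_detected:
  assumes T: "torsion_free_subgroup G T" "finite (rcosets T)"
    and h: "h \<in> carrier G" "h \<noteq> \<one>" and n: "h [^] (n::nat) = \<one>" "0 < n"
  shows "\<exists>(F :: nat monoid) f. group F \<and> finite (carrier F) \<and> f \<in> epi G F \<and> f h \<noteq> \<one>\<^bsub>F\<^esub>"
proof -
  have sub: "subgroup T G" using T by (simp add: torsion_free_subgroup_def)
  define \<tau> where "\<tau> = (\<lambda>g. \<lambda>C\<in>rcosets T. C #> g)"
  have closed: "C #> g \<in> rcosets T" if "C \<in> rcosets T" "g \<in> carrier G" for C g
    using that subgroup.subset[OF sub] coset_mult_assoc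
    by (auto simp: RCOSETS_def)
  have sub_C: "C \<subseteq> carrier G" if "C \<in> rcosets T" for C
    using that subgroup.rcosets_carrier[OF sub is_group] by blast
  have mult: "\<tau> (x \<otimes> y) = (\<lambda>C\<in>rcosets T. \<tau> y (\<tau> x C))"
    if "x \<in> carrier G" "y \<in> carrier G" for x y
    using that closed sub_C by (auto simp: \<tau>_def fun_eq_iff coset_mult_assoc)
  have "congruence_map G \<tau>" by (simp add: congruence_map_def mult)
  moreover have "\<tau> ` carrier G \<subseteq> (rcosets T) \<rightarrow>\<^sub>E (rcosets T)"
    using closed by (auto simp: \<tau>_def)
  then have "finite (\<tau> ` carrier G)" using T(2) by (meson finite_PiE finite_subset)
  moreover have "\<tau> h \<noteq> \<tau> \<one>"
  proof
    assume "\<tau> h = \<tau> \<one>"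
    moreover have "T \<in> rcosets T" using subgroup.subgroup_in_rcosets[OF sub is_group] .
    ultimately have "T #> h = T #> \<one>" by (metis \<tau>_def restrict_apply')
    then have "T #> h = T" using subgroup.subset[OF sub] by simp
    then have "h \<in> T" using coset_join1[OF _ h(1) sub] by simp
    then have "ord h = 0" using T h(2) by (simp add: torsion_free_subgroup_def)
    then show False using pow_eq_id[OF h(1), of n] n by simp
  qed
  ultimately show ?thesis using finite_image_of_congruence_map h(1) by blast
qed

section \<open>Outer automorphisms that change a conjugacy class\<close>

lemma hom_eq_on_generators:
  assumes "group G" "group F" and q: "q \<in> hom G F" "q' \<in> hom G F"
    and S: "S \<subseteq> carrier G" "\<And>s. s \<in> S \<Longrightarrow> q s = q' s" and x: "x \<in> generate G S"
  shows "q x = q' x"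
proof -
  interpret q: group_hom G F q using assms by (simp add: group_hom_def group_hom_axioms_def)
  interpret q': group_hom G F q' using assms by (simp add: group_hom_def group_hom_axioms_def)
  show ?thesis using x
  proof (induction rule: generate.induct)
    case (eng x y)
    then show ?case using group.generate_in_carrier[OF assms(1) S(1)] by simp
  qed (use S in auto)
qed

text \<open>Homomorphisms are determined by their values on a finite generating set.\<close>

lemma finite_hom:
  assumes "group G" "group F" "finite (carrier F)" "finitely_generated_subgroup G (carrier G)"
  shows "finite (hom G F \<inter> extensional (carrier G))"
proof -
  obtain S where S: "finite S" "S \<subseteq> carrier G" "generate G S = carrier G"
    using assms(4) by (auto simp: finitely_generated_subgroup_def)
  let ?\<Omega> = "hom G F \<inter> extensional (carrier G)"
  have "inj_on (\<lambda>q. restrict q S) ?\<Omega>"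
  proof (rule inj_onI)
    fix q q' assume q: "q \<in> ?\<Omega>" "q' \<in> ?\<Omega>" and eq: "restrict q S = restrict q' S"
    have "q s = q' s" if "s \<in> S" for s using eq that by (metis restrict_apply')
    then have "q x = q' x" if "x \<in> carrier G" for x
      using hom_eq_on_generators[of G F q q' S x] assms(1,2) q S that by blast
    then show "q = q'" using q by (intro extensionalityI[of _ "carrier G"]) auto
  qed
  moreover have "(\<lambda>q. restrict q S) ` ?\<Omega> \<subseteq> S \<rightarrow>\<^sub>E carrier F"
    using S(2) by (auto simp: hom_def)
  then have "finite ((\<lambda>q. restrict q S) ` ?\<Omega>)"
    using S(1) assms(3) by (meson finite_PiE finite_subset)
  ultimately show ?thesis by (rule finite_imageD[rotated])
qed

context group
begin

lemma carrier_AutoGroup: "carrier (AutoGroup G) = auto G"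
  by (simp add: AutoGroup_def)

lemma mult_AutoGroup:
  "\<lbrakk>f \<in> auto G; h \<in> auto G\<rbrakk> \<Longrightarrow> f \<otimes>\<^bsub>AutoGroup G\<^esub> h = compose (carrier G) f h"
  by (simp add: AutoGroup_def BijGroup_def auto_def)

lemma auto_closed: "\<lbrakk>f \<in> auto G; x \<in> carrier G\<rbrakk> \<Longrightarrow> f x \<in> carrier G"
  by (auto simp: auto_def hom_def)

lemma conjugate_in_refl: "x \<in> carrier G \<Longrightarrow> conjugate_in G x x"
  by (auto simp: conjugate_in_def intro!: bexI[of _ \<one>])

lemma conjugate_in_trans:
  assumes "conjugate_in G x y" "conjugate_in G y z" "x \<in> carrier G"
  shows "conjugate_in G x z"
proof -
  obtain g h where gh: "g \<in> carrier G" "h \<in> carrier G" "y = g \<otimes> x \<otimes> inv g" "z = h \<otimes> y \<otimes> inv h"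
    using assms by (auto simp: conjugate_in_def)
  then have "z = (h \<otimes> g) \<otimes> x \<otimes> inv (h \<otimes> g)"
    using assms(3) by (simp add: inv_mult_group m_assoc)
  then show ?thesis using gh by (auto simp: conjugate_in_def)
qed

text \<open>Let \<open>q\<close> map \<open>x\<close> and \<open>\<alpha> x\<close> to non-conjugate elements of a finite group. Composing \<open>q\<close> with an
  inner automorphism keeps the value at \<open>x\<close> in its class, and composing it with \<open>\<alpha>\<close> does not.
  A coset of \<open>Inn G\<close> acts on homomorphisms only as a multivalued map, and \<open>\<tau>\<close> records the set
  of all values, so that no representatives have to be chosen.\<close>

lemma Out_detects_class_change:
  assumes sep: "conjugacy_separable G" and fg: "finitely_generated_subgroup G (carrier G)"
    and c: "c \<in> carrier (Out G)" "\<alpha> \<in> c"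
    and x: "x \<in> carrier G" "\<not> conjugate_in G x (\<alpha> x)"
  shows "\<exists>\<tau> :: ('a \<Rightarrow> 'a) set \<Rightarrow> ('a \<Rightarrow> nat) \<Rightarrow> ('a \<Rightarrow> nat) set.
    finite (\<tau> ` carrier (Out G)) \<and> congruence_map (Out G) \<tau> \<and> \<tau> c \<noteq> \<tau> \<one>\<^bsub>Out G\<^esub>"
proof -
  interpret A: group "AutoGroup G" by (rule AutoGroup)
  interpret N: normal "Inn G" "AutoGroup G" by (rule Inn_normal)
  have cosets: "b \<subseteq> auto G" if "b \<in> carrier (Out G)" for b
    using that N.rcosets_carrier[OF A.is_group] by (auto simp: Out_def FactGroup_def carrier_AutoGroup)
  have \<alpha>: "\<alpha> \<in> auto G" using cosets c by blast
  obtain F :: "nat monoid" and q0 where F: "group F" "finite (carrier F)" and q0: "q0 \<in> epi G F"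
    and nc: "\<not> conjugate_in F (q0 x) (q0 (\<alpha> x))"
    using sep x auto_closed[OF \<alpha>] unfolding conjugacy_separable_def by meson
  interpret F: group F by (rule F)
  define \<Omega> where "\<Omega> = hom G F \<inter> extensional (carrier G)"
  define \<tau> where "\<tau> = (\<lambda>b. \<lambda>q\<in>\<Omega>. (\<lambda>\<beta>. compose (carrier G) q \<beta>) ` b)"
  have comp: "compose (carrier G) q \<beta> \<in> \<Omega>" if "q \<in> \<Omega>" "\<beta> \<in> auto G" for q \<beta>
    using that by (auto simp: \<Omega>_def hom_def auto_def compose_def Pi_iff)
  have mult: "\<tau> (b \<otimes>\<^bsub>Out G\<^esub> b') = (\<lambda>q\<in>\<Omega>. \<Union>q'\<in>\<tau> b q. \<tau> b' q')"
    if "b \<in> carrier (Out G)" "b' \<in> carrier (Out G)" for b b'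
  proof -
    have prod: "b \<otimes>\<^bsub>Out G\<^esub> b' = (\<Union>\<beta>\<in>b. \<Union>\<beta>'\<in>b'. {compose (carrier G) \<beta> \<beta>'})"
      using cosets[OF that(1)] cosets[OF that(2)] mult_AutoGroup
      by (auto simp: Out_def FactGroup_def set_mult_def subset_iff)
    have assoc: "compose (carrier G) q (compose (carrier G) \<beta> \<beta>')
        = compose (carrier G) (compose (carrier G) q \<beta>) \<beta>'" if "\<beta>' \<in> auto G" for q \<beta> \<beta>'
      using that by (intro compose_assoc) (auto simp: auto_def hom_def)
    show ?thesis
    proof (rule extensionalityI[of _ \<Omega>])
      fix q assume q: "q \<in> \<Omega>"
      have \<tau>q: "\<tau> b q = (\<lambda>\<beta>. compose (carrier G) q \<beta>) ` b" using q by (simp add: \<tau>_def)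
      have "\<tau> (b \<otimes>\<^bsub>Out G\<^esub> b') q
          = (\<Union>\<beta>\<in>b. (\<lambda>\<beta>'. compose (carrier G) q (compose (carrier G) \<beta> \<beta>')) ` b')"
        using q by (auto simp: \<tau>_def prod)
      also have "\<dots> = (\<Union>\<beta>\<in>b. \<tau> b' (compose (carrier G) q \<beta>))"
      proof (rule SUP_cong[OF refl])
        fix \<beta> assume "\<beta> \<in> b"
        then have "compose (carrier G) q \<beta> \<in> \<Omega>" using comp[OF q] cosets[OF that(1)] by blast
        moreover have "(\<lambda>\<beta>'. compose (carrier G) q (compose (carrier G) \<beta> \<beta>')) ` b'
            = (\<lambda>\<beta>'. compose (carrier G) (compose (carrier G) q \<beta>) \<beta>') ` b'"
          using cosets[OF that(2)] by (intro image_cong refl assoc) blast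
        ultimately show "(\<lambda>\<beta>'. compose (carrier G) q (compose (carrier G) \<beta> \<beta>')) ` b'
            = \<tau> b' (compose (carrier G) q \<beta>)"
          by (simp add: \<tau>_def)
      qed
      finally show "\<tau> (b \<otimes>\<^bsub>Out G\<^esub> b') q = (\<lambda>q\<in>\<Omega>. \<Union>q'\<in>\<tau> b q. \<tau> b' q') q"
        using q \<tau>q by simp
    qed (simp_all add: \<tau>_def)
  qed
  have "congruence_map (Out G) \<tau>" by (simp add: congruence_map_def mult)
  moreover have "\<tau> ` carrier (Out G) \<subseteq> \<Omega> \<rightarrow>\<^sub>E Pow \<Omega>"
    using cosets comp by (auto simp: \<tau>_def subset_iff)
  then have "finite (\<tau> ` carrier (Out G))"
    using finite_hom[OF is_group F fg, folded \<Omega>_def]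
    by (elim finite_subset) (intro finite_PiE finite_Pow_iff[THEN iffD2])
  moreover have "\<tau> c \<noteq> \<tau> \<one>\<^bsub>Out G\<^esub>"
  proof
    define q where "q = restrict q0 (carrier G)"
    have q: "q \<in> \<Omega>" using q0 by (auto simp: q_def \<Omega>_def epi_def hom_def)
    assume "\<tau> c = \<tau> \<one>\<^bsub>Out G\<^esub>"
    then have "\<tau> c q = \<tau> (Inn G) q" by (simp add: Out_def FactGroup_def)
    then have "compose (carrier G) q \<alpha> \<in> (\<lambda>\<beta>. compose (carrier G) q \<beta>) ` Inn G"
      using q c(2) by (auto simp: \<tau>_def)
    then obtain g where g: "g \<in> carrier G"
      and eq: "compose (carrier G) q \<alpha> = compose (carrier G) q (\<lambda>x\<in>carrier G. g \<otimes> x \<otimes> inv g)"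
      by (auto simp: Inn_def)
    have q\<alpha>: "q (\<alpha> x) = q (g \<otimes> x \<otimes> inv g)"
      using fun_cong[OF eq, of x] x(1) by (simp add: compose_eq)
    interpret q0: group_hom G F q0
      using q0 by (simp add: group_hom_def group_hom_axioms_def epi_def)
    have "q0 (\<alpha> x) = q0 g \<otimes>\<^bsub>F\<^esub> q0 x \<otimes>\<^bsub>F\<^esub> inv\<^bsub>F\<^esub> q0 g"
      using q\<alpha> g x(1) auto_closed[OF \<alpha> x(1)] by (simp add: q_def)
    then show False using nc q0.hom_closed[OF g] unfolding conjugate_in_def by blast
  qed
  ultimately show ?thesis by blast
qed

lemma inner_power_imp_Out_torsion:
  assumes c: "c \<in> carrier (Out G)" "\<alpha> \<in> c" and n: "\<alpha> [^]\<^bsub>AutoGroup G\<^esub> (n::nat) \<in> Inn G"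
  shows "c [^]\<^bsub>Out G\<^esub> n = \<one>\<^bsub>Out G\<^esub>"
proof -
  interpret A: group "AutoGroup G" by (rule AutoGroup)
  interpret N: normal "Inn G" "AutoGroup G" by (rule Inn_normal)
  interpret pr: group_hom "AutoGroup G" "Out G" "\<lambda>\<beta>. Inn G #>\<^bsub>AutoGroup G\<^esub> \<beta>"
    unfolding Out_def using N.r_coset_hom_Mod N.factorgroup_is_group
    by (simp add: group_hom_def group_hom_axioms_def)
  have cR: "c \<in> rcosets\<^bsub>AutoGroup G\<^esub> Inn G" using c by (simp add: Out_def FactGroup_def)
  then have \<alpha>: "\<alpha> \<in> carrier (AutoGroup G)"
    using c(2) N.rcosets_carrier[OF A.is_group] by blast
  have "c = Inn G #>\<^bsub>AutoGroup G\<^esub> \<alpha>"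
    using cR c(2) A.repr_independence[OF _ _ N.subgroup_axioms] by (auto simp: RCOSETS_def)
  then have "c [^]\<^bsub>Out G\<^esub> n = Inn G #>\<^bsub>AutoGroup G\<^esub> (\<alpha> [^]\<^bsub>AutoGroup G\<^esub> n)"
    using pr.hom_nat_pow[OF \<alpha>] by simp
  also have "\<dots> = Inn G" using n by (simp add: N.rcos_const)
  finally show ?thesis by (simp add: Out_def FactGroup_def)
qed

end

section \<open>Hyperbolic spaces and their ideal boundary\<close>

text \<open>Among the three sums of lengths of opposite edges of a quadrilateral, the largest exceeds
  the second one by at most \<open>2\<delta>\<close>. This symmetric form of the hyperbolicity inequality is
  easier to combine with linear arithmetic than Gromov products are.\<close>

locale hyperbolic_space =
  fixes M :: "'x metric" and \<delta> :: real
  assumes delta_nonneg: "0 \<le> \<delta>"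
    and four_point: "\<lbrakk>w \<in> mspace M; x \<in> mspace M; y \<in> mspace M; z \<in> mspace M\<rbrakk> \<Longrightarrow>
      mdist M w x + mdist M y z
        \<le> max (mdist M w y + mdist M x z) (mdist M w z + mdist M x y) + 2 * \<delta>"
begin

abbreviation X where "X \<equiv> mspace M"
abbreviation d where "d \<equiv> mdist M"

lemma gromov_product_min:
  assumes "w \<in> X" "x \<in> X" "y \<in> X" "z \<in> X"
  shows "min (gromov_product M w x y) (gromov_product M w y z) - \<delta> \<le> gromov_product M w x z"
  using four_point[OF assms(2,4,3,1)] mdist_commute[of M]
  by (simp add: gromov_product_def min_def max_def field_simps split: if_splits)

lemma gromov_product_commute: "gromov_product M w x y = gromov_product M w y x"
  by (simp add: gromov_product_def mdist_commute)

lemma gromov_product_base: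
  assumes "v \<in> X" "w \<in> X" "x \<in> X" "y \<in> X"
  shows "gromov_product M v x y - d v w \<le> gromov_product M w x y"
  using mdist_triangle[of x M w v] mdist_triangle[of y M w v] assms
  by (simp add: gromov_product_def mdist_commute field_simps)

text \<open>A change of the base point alters Gromov products by a bounded amount, so that one base
  point decides.\<close>

lemma gromov_asymptotic_iff:
  assumes "p \<in> X" "range x \<subseteq> X" "range y \<subseteq> X"
  shows "gromov_asymptotic M x y \<longleftrightarrow>
    (\<forall>K. \<exists>N. \<forall>i\<ge>N. \<forall>j\<ge>N. K \<le> gromov_product M p (x i) (y j))" (is "_ \<longleftrightarrow> ?R p")
proof -
  have "?R w" if "?R p" "w \<in> X" for w
  proof
    fix K
    obtain N where N: "\<And>i j. \<lbrakk>i \<ge> N; j \<ge> N\<rbrakk> \<Longrightarrow> K + d p w \<le> gromov_product M p (x i) (y j)"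
      using \<open>?R p\<close> by blast
    have "K \<le> gromov_product M w (x i) (y j)" if "i \<ge> N" "j \<ge> N" for i j
      using gromov_product_base[of p w "x i" "y j"] N[OF that] assms \<open>w \<in> X\<close> by force
    then show "\<exists>N. \<forall>i\<ge>N. \<forall>j\<ge>N. K \<le> gromov_product M w (x i) (y j)" by blast
  qed
  moreover have "gromov_asymptotic M x y \<longleftrightarrow> (\<forall>w\<in>X. ?R w)"
    unfolding gromov_asymptotic_def filterlim_at_top eventually_prod_sequentially prod.case by meson
  ultimately show ?thesis using assms(1) by blast
qed

lemma gromov_asymptotic_sym: "gromov_asymptotic M x y \<Longrightarrow> gromov_asymptotic M y x"
  unfolding gromov_asymptotic_def filterlim_at_top eventually_prod_sequentially
  by (simp add: gromov_product_commute) (meson gromov_product_commute)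

lemma gromov_asymptotic_trans:
  assumes "gromov_asymptotic M x y" "gromov_asymptotic M y z"
    and X: "range x \<subseteq> X" "range y \<subseteq> X" "range z \<subseteq> X"
  shows "gromov_asymptotic M x z"
proof -
  obtain p where p: "p \<in> X" using X by blast
  show ?thesis
    unfolding gromov_asymptotic_iff[OF p X(1,3)]
  proof
    fix K
    obtain N1 N2
      where N1: "\<And>i j. \<lbrakk>i \<ge> N1; j \<ge> N1\<rbrakk> \<Longrightarrow> K + \<delta> \<le> gromov_product M p (x i) (y j)"
        and N2: "\<And>i j. \<lbrakk>i \<ge> N2; j \<ge> N2\<rbrakk> \<Longrightarrow> K + \<delta> \<le> gromov_product M p (y i) (z j)"
      using assms(1,2) unfolding gromov_asymptotic_iff[OF p X(1,2)] gromov_asymptotic_iff[OF p X(2,3)]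
      by meson
    let ?N = "max N1 N2"
    have "K \<le> gromov_product M p (x i) (z j)" if "i \<ge> ?N" "j \<ge> ?N" for i j
      using gromov_product_min[of p "x i" "y ?N" "z j"] p X N1[of i ?N] N2[of ?N j] that by force
    then show "\<exists>N. \<forall>i\<ge>N. \<forall>j\<ge>N. K \<le> gromov_product M p (x i) (z j)" by blast
  qed
qed

abbreviation asymptotic_rel where
  "asymptotic_rel \<equiv>
     {(x, y). x \<in> gromov_sequences M \<and> y \<in> gromov_sequences M \<and> gromov_asymptotic M x y}"

lemma equiv_asymptotic: "equiv (gromov_sequences M) asymptotic_rel"
proof (rule equivI)
  show "asymptotic_rel \<subseteq> gromov_sequences M \<times> gromov_sequences M" by blast
  show "refl_on (gromov_sequences M) asymptotic_rel"
    by (auto simp: refl_on_def gromov_sequences_def)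
  show "sym asymptotic_rel" by (auto simp: sym_def intro: gromov_asymptotic_sym)
  show "trans asymptotic_rel"
    by (auto simp: trans_def gromov_sequences_def intro: gromov_asymptotic_trans)
qed

lemma ideal_boundary_eqI:
  assumes "\<xi> \<in> ideal_boundary M" "\<eta> \<in> ideal_boundary M" "u \<in> \<xi>" "v \<in> \<eta>" "gromov_asymptotic M u v"
  shows "\<xi> = \<eta>"
proof (rule quotient_eqI[OF equiv_asymptotic])
  have "u \<in> gromov_sequences M" "v \<in> gromov_sequences M"
    using assms Union_quotient[OF equiv_asymptotic] unfolding ideal_boundary_def by blast+
  then show "(u, v) \<in> asymptotic_rel" using assms by blast
qed (use assms in \<open>auto simp: ideal_boundary_def\<close>)

lemma ideal_boundary_asymptotic:
  assumes "\<xi> \<in> ideal_boundary M" "u \<in> \<xi>" "v \<in> \<xi>"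
  shows "gromov_asymptotic M u v"
  using assms quotient_eq_iff[OF equiv_asymptotic, of \<xi> \<xi> u v] unfolding ideal_boundary_def by blast

lemma ideal_boundary_range:
  assumes "\<xi> \<in> ideal_boundary M" "u \<in> \<xi>"
  shows "range u \<subseteq> X"
  using assms Union_quotient[OF equiv_asymptotic]
  unfolding ideal_boundary_def gromov_sequences_def by blast

lemma ideal_boundary_nonempty: "\<xi> \<in> ideal_boundary M \<Longrightarrow> \<exists>u. u \<in> \<xi>"
  using in_quotient_imp_non_empty[OF equiv_asymptotic] unfolding ideal_boundary_def by blast

text \<open>The bound \<open>K\<close> depends on the two boundary points alone; the representing sequences influence
  only the index from which it holds. This uniformity is what makes the bound usable for all
  elements that fix both points.\<close>

lemma not_asymptotic_bounded:
  assumes p: "p \<in> X" and X: "range u \<subseteq> X" "range v \<subseteq> X" and uv: "\<not> gromov_asymptotic M u v"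
  obtains K where
    "\<And>u' v'. \<lbrakk>range u' \<subseteq> X; range v' \<subseteq> X; gromov_asymptotic M u' u; gromov_asymptotic M v' v\<rbrakk> \<Longrightarrow>
      \<exists>N. \<forall>i\<ge>N. \<forall>j\<ge>N. gromov_product M p (u' i) (v' j) \<le> K"
proof -
  let ?gp = "gromov_product M p"
  obtain K where K: "\<And>N. \<exists>i\<ge>N. \<exists>j\<ge>N. ?gp (u i) (v j) < K"
    using uv unfolding gromov_asymptotic_iff[OF p X] by (meson linorder_not_le)
  have "\<exists>N. \<forall>i\<ge>N. \<forall>j\<ge>N. ?gp (u' i) (v' j) \<le> K + 2 * \<delta>"
    if X': "range u' \<subseteq> X" "range v' \<subseteq> X" and uv': "gromov_asymptotic M u' u" "gromov_asymptotic M v' v"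
    for u' v'
  proof -
    obtain N1 N2
      where N1: "\<And>i j. \<lbrakk>i \<ge> N1; j \<ge> N1\<rbrakk> \<Longrightarrow> K + 2 * \<delta> \<le> ?gp (u' i) (u j)"
        and N2: "\<And>i j. \<lbrakk>i \<ge> N2; j \<ge> N2\<rbrakk> \<Longrightarrow> K + 2 * \<delta> \<le> ?gp (v' i) (v j)"
      using uv'[unfolded gromov_asymptotic_iff[OF p X'(1) X(1)] gromov_asymptotic_iff[OF p X'(2) X(2)],
        rule_format, of "K + 2 * \<delta>"]
      by blast
    let ?N = "max N1 N2"
    obtain i0 j0 where ij: "i0 \<ge> ?N" "j0 \<ge> ?N" "?gp (u i0) (v j0) < K" using K by blast
    have "?gp (u' i) (v' j) \<le> K + 2 * \<delta>" if "i \<ge> ?N" "j \<ge> ?N" for i j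
    proof -
      have X4: "u i0 \<in> X" "v j0 \<in> X" "u' i \<in> X" "v' j \<in> X" using X X' by auto
      have "K + 2 * \<delta> \<le> ?gp (u i0) (u' i)" "K + 2 * \<delta> \<le> ?gp (v' j) (v j0)"
        using N1[of i i0] N2[of j j0] ij that gromov_product_commute by auto
      with gromov_product_min[OF p X4(1,3,2)] gromov_product_min[OF p X4(3,4,2)] ij(3) delta_nonneg
      show ?thesis by (auto simp: min_def split: if_splits)
    qed
    then show ?thesis by blast
  qed
  then show thesis by (rule that)
qed

end

lemma gromov_hyperbolic_imp_hyperbolic_space:
  assumes "gromov_hyperbolic M"
  obtains \<delta> where "hyperbolic_space M \<delta>"
proof -
  obtain \<delta> where \<delta>: "\<forall>w \<in> mspace M. \<forall>x \<in> mspace M. \<forall>y \<in> mspace M. \<forall>z \<in> mspace M.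
     gromov_product M w x z \<ge> min (gromov_product M w x y) (gromov_product M w y z) - \<delta>"
    using assms unfolding gromov_hyperbolic_def by blast
  have "hyperbolic_space M (max \<delta> 0)"
  proof
    fix w x y z assume *: "w \<in> mspace M" "x \<in> mspace M" "y \<in> mspace M" "z \<in> mspace M"
    show "mdist M w x + mdist M y z
        \<le> max (mdist M w y + mdist M x z) (mdist M w z + mdist M x y) + 2 * max \<delta> 0"
      using \<delta>[rule_format, of z w y x] * mdist_commute[of M]
      by (auto simp: gromov_product_def min_def max_def field_simps split: if_splits)
  qed simp
  then show thesis by (rule that)
qed

text \<open>A path of length below \<open>d(x, y) + 1\<close> passes through points at every intermediate distance
  from \<open>x\<close>. These points take over the role of points on a geodesic.\<close>

lemma path_metric_rough_geodesic:
  assumes "path_metric_space M" "x \<in> mspace M" "y \<in> mspace M" "0 \<le> t" "t \<le> mdist M x y"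
  obtains z where "z \<in> mspace M" "mdist M x z = t" "mdist M z y \<le> mdist M x y - t + 1"
proof -
  let ?P = "{\<gamma>. pathin (mtopology_of M) \<gamma> \<and> \<gamma> 0 = x \<and> \<gamma> 1 = y}"
  have "(INF \<gamma> \<in> ?P. path_len M \<gamma>) = ereal (mdist M x y)"
    using assms(1-3) by (simp add: path_metric_space_def)
  also have "\<dots> < ereal (mdist M x y + 1)" by simp
  finally obtain \<gamma> where \<gamma>: "pathin (mtopology_of M) \<gamma>" "\<gamma> 0 = x" "\<gamma> 1 = y"
    and len: "path_len M \<gamma> < ereal (mdist M x y + 1)"
    by (auto simp: INF_less_iff)
  have inM: "\<gamma> s \<in> mspace M" if "s \<in> {0..1}" for s
    using path_image_subset_topspace[OF \<gamma>(1)] that by auto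
  have "continuous_map (subtopology euclideanreal {0..1}) euclidean (\<lambda>s. mdist M x (\<gamma> s))"
    using \<gamma>(1) assms(2) by (intro continuous_map_mdist) (auto simp: pathin_def)
  then have cont: "continuous_on {0..1} (\<lambda>s. mdist M x (\<gamma> s))" by simp
  have start: "mdist M x (\<gamma> 0) = 0" using assms(2) \<gamma>(2) by simp
  obtain s where s: "0 \<le> s" "s \<le> 1" "mdist M x (\<gamma> s) = t"
    using IVT'[of "\<lambda>s. mdist M x (\<gamma> s)" 0 t 1] start cont \<gamma>(3) assms(4,5) by force
  \<comment> \<open>The subdivision with the single inner node \<open>s\<close> bounds the length of the two halves of the path.\<close>
  let ?t = "\<lambda>i::nat. if i = 0 then 0 else if i = 1 then s else (1::real)"
  have "ereal (\<Sum>i<2. mdist M (\<gamma> (?t i)) (\<gamma> (?t (Suc i)))) \<le> path_len M \<gamma>"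
    unfolding path_len_def
    by (rule SUP_upper2[where i = "(2, ?t)"]) (use s in \<open>auto simp: mono_on_def\<close>)
  then have "ereal (mdist M x (\<gamma> s) + mdist M (\<gamma> s) y) \<le> path_len M \<gamma>"
    using \<gamma>(2,3) by (simp add: numeral_2_eq_2)
  then have "ereal (mdist M x (\<gamma> s) + mdist M (\<gamma> s) y) < ereal (mdist M x y + 1)"
    using len by (rule le_less_trans)
  with s inM[of s] show thesis by (intro that[of "\<gamma> s"]) auto
qed

section \<open>Proper isometric actions on hyperbolic spaces\<close>

text \<open>In a proper space, finiteness of the sets of elements with bounded displacement at a point
  is the form in which proper discontinuity enters all the arguments.\<close>

locale hyperbolic_action = hyperbolic_space M \<delta> + group_action G "mspace M" \<phi>
  for M :: "'x metric" and \<delta> and G :: "('g, 'm) monoid_scheme" (structure) and \<phi> +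
  assumes isometric: "\<lbrakk>g \<in> carrier G; x \<in> X; y \<in> X\<rbrakk> \<Longrightarrow> d (\<phi> g x) (\<phi> g y) = d x y"
    and rough_geodesic: "\<lbrakk>x \<in> X; y \<in> X; 0 \<le> t; t \<le> d x y\<rbrakk> \<Longrightarrow>
      \<exists>z\<in>X. d x z = t \<and> d z y \<le> d x y - t + 1"
    and proper: "proper_metric_space M"
    and finite_displacement: "x \<in> X \<Longrightarrow> finite {g \<in> carrier G. d x (\<phi> g x) \<le> r}"
begin

sublocale group G
  using group_hom by (rule group_hom.axioms)

lemma act_closed [simp]: "\<lbrakk>g \<in> carrier G; x \<in> X\<rbrakk> \<Longrightarrow> \<phi> g x \<in> X"
  by (rule element_image) auto

lemma act_mult: "\<lbrakk>g \<in> carrier G; h \<in> carrier G; x \<in> X\<rbrakk> \<Longrightarrow> \<phi> (g \<otimes> h) x = \<phi> g (\<phi> h x)"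
  by (rule composition_rule)

lemma act_one [simp]: "x \<in> X \<Longrightarrow> \<phi> \<one> x = x"
  using id_eq_one by (metis restrict_apply')

lemma act_inv_left [simp]: "\<lbrakk>g \<in> carrier G; x \<in> X\<rbrakk> \<Longrightarrow> \<phi> (inv g) (\<phi> g x) = x"
  by (simp flip: act_mult)

lemma act_inv_right [simp]: "\<lbrakk>g \<in> carrier G; x \<in> X\<rbrakk> \<Longrightarrow> \<phi> g (\<phi> (inv g) x) = x"
  by (simp flip: act_mult)

lemma dist_act_left: "\<lbrakk>g \<in> carrier G; x \<in> X; y \<in> X\<rbrakk> \<Longrightarrow> d (\<phi> g x) y = d x (\<phi> (inv g) y)"
  using isometric[of g x "\<phi> (inv g) y"] by simp

lemma dist_act_inv: "\<lbrakk>g \<in> carrier G; x \<in> X\<rbrakk> \<Longrightarrow> d x (\<phi> (inv g) x) = d x (\<phi> g x)"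
  using isometric[of g x "\<phi> (inv g) x"] by (simp add: mdist_commute)

end

section \<open>Almost fixed points\<close>

context hyperbolic_action
begin

text \<open>Equivalently \<open>(x | g\<^sup>2 x)\<close> with respect to \<open>g x\<close> is at least \<open>(d(x, g x) - c) / 2\<close> for all
  \<open>x\<close>: the second step of each orbit retraces half of the first one, up to \<open>c / 2\<close>. Elliptic
  and parabolic isometries of a tree-like space behave in this way, whereas an isometry with
  large translation length moves on along its axis.\<close>

definition backtracks :: "real \<Rightarrow> 'g \<Rightarrow> bool" where
  "backtracks c g \<longleftrightarrow> (\<forall>x\<in>X. d x (\<phi> g (\<phi> g x)) \<le> d x (\<phi> g x) + c)"

lemma backtracksD: "\<lbrakk>backtracks c g; x \<in> X\<rbrakk> \<Longrightarrow> d x (\<phi> g (\<phi> g x)) \<le> d x (\<phi> g x) + c"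
  by (simp add: backtracks_def)

text \<open>The four-point inequality for \<open>x\<close>, \<open>g\<^sup>2 x\<close>, \<open>g x\<close> and \<open>p\<close>, where \<open>g\<close> alters distances to \<open>p\<close>
  by at most \<open>L\<close>.\<close>

lemma small_displacement_imp_backtracks:
  assumes g: "g \<in> carrier G" and p: "p \<in> X" "d p (\<phi> g p) \<le> L"
  shows "backtracks (L + 2 * \<delta>) g"
  unfolding backtracks_def
proof
  fix x assume x: "x \<in> X"
  have 1: "d (\<phi> g (\<phi> g x)) p \<le> d (\<phi> g x) p + L"
    using mdist_triangle[of "\<phi> g (\<phi> g x)" M "\<phi> g p" p] isometric[of g "\<phi> g x" p] g p x
    by (simp add: mdist_commute)
  have 2: "d x p \<le> d (\<phi> g x) p + L"
    using mdist_triangle[of "\<phi> g x" M p "\<phi> g p"] isometric[of g x p] g p x by simp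
  have 3: "d (\<phi> g x) (\<phi> g (\<phi> g x)) = d x (\<phi> g x)"
    using isometric[of g x "\<phi> g x"] g x by simp
  have "d x (\<phi> g (\<phi> g x)) + d (\<phi> g x) p
      \<le> max (d x (\<phi> g x) + d (\<phi> g (\<phi> g x)) p) (d x p + d (\<phi> g (\<phi> g x)) (\<phi> g x)) + 2 * \<delta>"
    using g p x by (intro four_point) auto
  then show "d x (\<phi> g (\<phi> g x)) \<le> d x (\<phi> g x) + (L + 2 * \<delta>)"
    using 1 2 3 mdist_commute[of M "\<phi> g (\<phi> g x)" "\<phi> g x"] by linarith
qed

text \<open>In a tree: as \<open>a\<close> and \<open>b\<close> backtrack, the segments from \<open>x\<close> to \<open>a x\<close> and to \<open>a\<inverse> x\<close> share
  their first halves, and so do those to \<open>b x\<close> and \<open>b\<inverse> x\<close>. If the \<open>a\<close>-direction and the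
  \<open>b\<close>-direction separated earlier, at distance \<open>q\<close>, then the segments to \<open>a b x\<close> and to \<open>(a
  b)\<inverse> x\<close> would separate at distance \<open>q\<close> too, and \<open>a b\<close> would not backtrack.\<close>

lemma backtracks_product:
  assumes a: "a \<in> carrier G" and b: "b \<in> carrier G" and x: "x \<in> X" and c: "0 \<le> c"
    and bt: "backtracks c a" "backtracks c b" "backtracks c (a \<otimes> b)"
  shows "min (d x (\<phi> a x)) (d x (\<phi> b x)) / 2 - c / 2 - 2 * \<delta>
           \<le> gromov_product M x (\<phi> (inv a) x) (\<phi> b x)"
proof -
  define A B P where "A = d x (\<phi> a x)" "B = d x (\<phi> b x)" "P = d x (\<phi> a (\<phi> b x))"
  let ?a = "\<phi> a x" and ?a' = "\<phi> (inv a) x" and ?b = "\<phi> b x" and ?b' = "\<phi> (inv b) x"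
  let ?ab = "\<phi> a (\<phi> b x)" and ?ab' = "\<phi> (inv b) (\<phi> (inv a) x)"
  let ?p = "gromov_product M x"
  have in_X: "?a \<in> X" "?a' \<in> X" "?b \<in> X" "?b' \<in> X" "?ab \<in> X" "?ab' \<in> X"
    using a b x by auto
  have ab: "a \<otimes> b \<in> carrier G" using a b by simp
  have dA: "d ?a x = A" "d ?a' x = A" "d ?b x = B" "d ?b' x = B" "d ?ab x = P"
    using dist_act_inv[OF a x] dist_act_inv[OF b x] by (auto simp: A_B_P_def mdist_commute)
  have dab': "d ?ab' x = P"
    using dist_act_inv[OF ab x] a b x
    by (simp add: A_B_P_def inv_mult_group act_mult mdist_commute)
  have d1: "d ?a' ?b = P"
    using dist_act_left[of "inv a" x ?b] a x in_X by (simp add: A_B_P_def)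
  have d2: "d ?a ?ab = B" using isometric[OF a x in_X(3)] by (simp add: A_B_P_def)
  have d3: "d ?b' ?ab' = A"
    using isometric[of "inv b" x ?a'] dist_act_inv[OF a x] a b x by (simp add: A_B_P_def)
  have d4: "d ?a' ?a \<le> A + c"
    using backtracksD[OF bt(1) x] dist_act_left[of "inv a" x ?a] a x by (simp add: A_B_P_def)
  have d5: "d ?b' ?b \<le> B + c"
    using backtracksD[OF bt(2) x] dist_act_left[of "inv b" x ?b] b x by (simp add: A_B_P_def)
  have d6: "d ?ab' ?ab \<le> P + c"
    using backtracksD[OF bt(3) x] dist_act_left[of "inv (a \<otimes> b)" x ?ab] a b x in_X ab
    by (simp add: A_B_P_def act_mult inv_mult_group)
  have h1: "min (?p ?a' ?a) (?p ?a ?b) - \<delta> \<le> ?p ?a' ?b"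
    using x in_X by (intro gromov_product_min)
  have h2: "min (?p ?a ?b') (?p ?b' ?b) - \<delta> \<le> ?p ?a ?b"
    using x in_X by (intro gromov_product_min)
  have h3: "min (?p ?a ?ab) (?p ?ab ?b') - \<delta> \<le> ?p ?a ?b'"
    using x in_X by (intro gromov_product_min)
  have h4: "min (?p ?ab ?ab') (?p ?ab' ?b') - \<delta> \<le> ?p ?ab ?b'"
    using x in_X by (intro gromov_product_min)
  have p: "?p ?a' ?b = (A + B - P) / 2" "?p ?a ?ab = (A + P - B) / 2"
      "?p ?ab' ?b' = (P + B - A) / 2" "?p ?a' ?a \<ge> (A - c) / 2" "?p ?b' ?b \<ge> (B - c) / 2"
      "?p ?ab ?ab' \<ge> (P - c) / 2"
    using dA dab' d1 d2 d3 d4 d5 d6 mdist_commute[of M ?ab' ?b'] mdist_commute[of M ?ab' ?ab]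
    by (auto simp: gromov_product_def)
  show ?thesis
  proof (rule ccontr)
    define q where "q = ?p ?a' ?b"
    assume "\<not> ?thesis"
    then have q: "q < A / 2 - c / 2 - 2 * \<delta>" "q < B / 2 - c / 2 - 2 * \<delta>"
      by (auto simp: A_B_P_def q_def)
    have P: "P = A + B - 2 * q" using p(1) by (simp add: q_def)
    \<comment> \<open>The chain \<open>a\<inverse> x\<close>, \<open>a x\<close>, \<open>b x\<close>, \<open>b\<inverse> x\<close>, \<open>a b x\<close>, \<open>(a b)\<inverse> x\<close> carries the bound \<open>q\<close> on the first
      product over to the last one, at the cost of one \<open>\<delta>\<close> for each link.\<close>
    have "?p ?a ?b \<le> q + \<delta>" using h1 p(4) q delta_nonneg
      by (auto simp: q_def min_def field_simps split: if_splits)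
    then have "?p ?a ?b' \<le> q + 2 * \<delta>" using h2 p(5) q
      by (auto simp: min_def field_simps split: if_splits)
    then have "?p ?ab ?b' \<le> q + 3 * \<delta>" using h3 p(2) q P c delta_nonneg
      by (auto simp: min_def field_simps split: if_splits)
    then have "(P - c) / 2 \<le> q + 4 * \<delta>" using h4 p(3,6) q P c delta_nonneg
      by (auto simp: min_def field_simps split: if_splits)
    then show False using q c P by simp
  qed
qed

text \<open>All segments from \<open>x\<close> to \<open>s x\<close> and to \<open>s\<inverse> x\<close> with \<open>d(x, s x)\<close> close to the maximum start in
  a common direction, by the previous lemma. A step of length \<open>r\<close> in this direction diminishes
  the large displacements by almost \<open>2r\<close>, and increases the others by at most \<open>2r\<close>, which they
  can afford. The step length \<open>r = 2 + 3\<delta>\<close> outweighs the error terms, and the bound on \<open>m\<close> is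
  what makes the common initial segment longer than \<open>r\<close>.\<close>

lemma almost_fixed_point_descent:
  assumes S: "S \<subseteq> carrier G" and c: "0 \<le> c"
    and bt: "\<And>s. s \<in> S \<Longrightarrow> backtracks c s"
      "\<And>s t. \<lbrakk>s \<in> S; t \<in> S\<rbrakk> \<Longrightarrow> backtracks c (s \<otimes> t)"
    and x: "x \<in> X" "\<And>s. s \<in> S \<Longrightarrow> d x (\<phi> s x) \<le> m" and m: "9 + 18 * \<delta> + c \<le> m"
  shows "\<exists>z\<in>X. \<forall>s\<in>S. d z (\<phi> s z) \<le> m - 1"
proof (cases "\<exists>a\<in>S. m - 1 < d x (\<phi> a x)")
  case False
  then show ?thesis using x by force
next
  case True
  then obtain a where a: "a \<in> S" "m - 1 < d x (\<phi> a x)" by blast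
  define r where "r = 2 + 3 * \<delta>"
  let ?a = "\<phi> (inv a) x" and ?p = "gromov_product M x"
  have aG: "a \<in> carrier G" and aX: "?a \<in> X" using a S x by auto
  have da: "d x ?a = d x (\<phi> a x)" using dist_act_inv[OF aG x(1)] .
  obtain z where z: "z \<in> X" "d x z = r" "d z ?a \<le> d x ?a - r + 1"
    using rough_geodesic[OF x(1) aX, of r] da a(2) m delta_nonneg c r_def by force
  have za: "r - 1 / 2 \<le> ?p z ?a"
    using z by (simp add: gromov_product_def mdist_commute field_simps)
  have "d z (\<phi> b z) \<le> m - 1" if b: "b \<in> S" for b
  proof (cases "d x (\<phi> b x) \<le> m - 2 * r - 1")
    case True
    have "d z (\<phi> b z) \<le> d z x + d x (\<phi> b x) + d (\<phi> b x) (\<phi> b z)"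
      using mdist_triangle[of z M x "\<phi> b z"] mdist_triangle[of x M "\<phi> b x" "\<phi> b z"] x z b S
      by force
    then show ?thesis
      using True isometric[of b x z] x z b S by (auto simp: mdist_commute)
  next
    case False
    have bG: "b \<in> carrier G" using b S by auto
    let ?b = "\<phi> b x" and ?b' = "\<phi> (inv b) x"
    have in_X: "?b \<in> X" "?b' \<in> X" "\<phi> b z \<in> X" using bG x z by auto
    define B where "B = d x ?b"
    have dB: "d ?b x = B" "d ?b' x = B" "B \<le> m"
      using dist_act_inv[OF bG x(1)] x(2)[OF b] by (auto simp: B_def mdist_commute)
    have "min (d x (\<phi> a x)) B / 2 - c / 2 - 2 * \<delta> \<le> ?p ?a ?b"
      unfolding B_def using a b x(1) aG bG c bt by (intro backtracks_product) auto
    then have q: "(m - 2 * r - 1) / 2 - c / 2 - 2 * \<delta> \<le> ?p ?a ?b"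
      using a False B_def r_def delta_nonneg by (auto simp: min_def field_simps split: if_splits)
    have "d ?b' ?b \<le> B + c"
      using backtracksD[OF bt(1)[OF b] x(1)] dist_act_left[of "inv b" x ?b] bG x
      by (simp add: B_def)
    then have "(B - c) / 2 \<le> ?p ?b ?b'"
      using dB by (simp add: gromov_product_def mdist_commute)
    then have q': "(m - 2 * r - 1) / 2 - c / 2 - 3 * \<delta> \<le> ?p ?a ?b'"
      using gromov_product_min[OF x(1) aX in_X(1,2)] q False delta_nonneg
      by (auto simp: min_def B_def field_simps split: if_splits)
    have "r - 1 / 2 - \<delta> \<le> ?p z ?b" "r - 1 / 2 - \<delta> \<le> ?p z ?b'"
      using gromov_product_min[OF x(1) z(1) aX in_X(1)] gromov_product_min[OF x(1) z(1) aX in_X(2)]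
        za q q' m delta_nonneg unfolding r_def by (auto simp: min_def field_simps split: if_splits)
    then have zb: "d z ?b \<le> B - r + 1 + 2 * \<delta>" "d z ?b' \<le> B - r + 1 + 2 * \<delta>"
      using dB z by (auto simp: gromov_product_def mdist_commute field_simps)
    have "d (\<phi> b z) x = d z ?b'" using dist_act_left[OF bG z(1) x(1)] .
    moreover have "d ?b (\<phi> b z) = r" using isometric[OF bG x(1) z(1)] z by simp
    moreover have "d z (\<phi> b z) + d x ?b
        \<le> max (d z x + d (\<phi> b z) ?b) (d z ?b + d (\<phi> b z) x) + 2 * \<delta>"
      using in_X x z by (intro four_point)
    ultimately have "d z (\<phi> b z) + B \<le> max (2 * r) (2 * (B - r + 1 + 2 * \<delta>)) + 2 * \<delta>"
      using zb z(2) by (simp add: B_def mdist_commute)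
    then show ?thesis
      using dB(3) False m c delta_nonneg unfolding r_def B_def
      by (auto simp: max_def field_simps split: if_splits)
  qed
  then show ?thesis using z(1) by blast
qed

text \<open>A coarse version of Serre's lemma: if the elements of \<open>S\<close> and their pairwise products fix
  points of a tree, then \<open>S\<close> has a common fixed point. The constant does not depend on \<open>S\<close>.\<close>

lemma almost_fixed_point:
  assumes "finite S" "X \<noteq> {}" and S: "S \<subseteq> carrier G" and c: "0 \<le> c"
    and bt: "\<And>s. s \<in> S \<Longrightarrow> backtracks c s"
      "\<And>s t. \<lbrakk>s \<in> S; t \<in> S\<rbrakk> \<Longrightarrow> backtracks c (s \<otimes> t)"
  shows "\<exists>x\<in>X. \<forall>s\<in>S. d x (\<phi> s x) \<le> 9 + 18 * \<delta> + c"
proof -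
  let ?K = "9 + 18 * \<delta> + c"
  have descent: "\<exists>x\<in>X. \<forall>s\<in>S. d x (\<phi> s x) \<le> ?K" if "\<exists>x\<in>X. \<forall>s\<in>S. d x (\<phi> s x) \<le> ?K + real n" for n
    using that
  proof (induction n)
    case (Suc n)
    then obtain x where "x \<in> X" "\<And>s. s \<in> S \<Longrightarrow> d x (\<phi> s x) \<le> ?K + real (Suc n)" by blast
    then have "\<exists>x\<in>X. \<forall>s\<in>S. d x (\<phi> s x) \<le> ?K + real (Suc n) - 1"
      by (intro almost_fixed_point_descent[OF S c bt]) auto
    then show ?case by (intro Suc.IH) (simp add: algebra_simps)
  qed simp
  obtain x where x: "x \<in> X" using assms by blast
  have "finite ((\<lambda>s. d x (\<phi> s x)) ` S)" using assms by blast
  then obtain B where B: "\<And>s. s \<in> S \<Longrightarrow> d x (\<phi> s x) \<le> B"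
    using bdd_above_finite unfolding bdd_above_def by (metis imageI)
  obtain n :: nat where "B \<le> real n" using real_arch_simple by blast
  then show ?thesis using B x delta_nonneg c by (intro descent[of n]) force
qed

end

section \<open>Elements that do not backtrack\<close>

lemma int_approx_minimum:
  fixes f :: "int \<Rightarrow> real"
  assumes "\<And>n. 0 \<le> f n" "0 < e"
  obtains m where "\<And>n. f m \<le> f n + e"
proof -
  have bb: "bdd_below (range f)" using assms(1) by (auto simp: bdd_below_def)
  have "Inf (range f) < Inf (range f) + e" using assms(2) by simp
  then obtain m where "f m < Inf (range f) + e"
    using cInf_lessD[of "range f"] by blast
  moreover have "Inf (range f) \<le> f n" for n using bb by (simp add: cInf_lower)
  ultimately have "f m \<le> f n + e" for n by (smt (verit))
  then show thesis by (rule that)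
qed

context hyperbolic_action
begin

text \<open>Let \<open>g\<^sup>m x\<close> be a nearly nearest point of the orbit to \<open>y\<close>. As the orbit does not backtrack
  at \<open>g\<^sup>m x\<close>, one of its two neighbours is farther from \<open>y\<close> by more than \<open>2\<delta>\<close>. Therefore the
  path from \<open>y\<close> to \<open>g y\<close> has to descend to the orbit, follow it by one step and climb back, so
  that its length bounds the distance of \<open>y\<close> from the orbit.\<close>

lemma not_backtracks_near_orbit:
  assumes g: "g \<in> carrier G" and x: "x \<in> X"
    and far: "d x (\<phi> g x) + 4 * \<delta> + 1 < d x (\<phi> g (\<phi> g x))"
    and y: "y \<in> X" "d y (\<phi> g y) \<le> C"
  shows "\<exists>m::int. d y (\<phi> (g [^] m) x) \<le> (C + d x (\<phi> g x)) / 2"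
proof -
  define D where "D = d x (\<phi> g x)"
  define orb where "orb = (\<lambda>m::int. \<phi> (g [^] m) x)"
  have oX: "orb m \<in> X" for m using g x by (simp add: orb_def)
  have shift: "\<phi> g (orb m) = orb (m + 1)" for m
    using g x by (simp add: orb_def flip: act_mult)
      (metis add.commute int_pow_1 int_pow_mult)
  have D1: "d (orb m) (orb (m + 1)) = D" for m
  proof -
    have "orb (m + 1) = \<phi> (g [^] m) (\<phi> g x)"
      using g x by (simp add: orb_def int_pow_mult act_mult)
    then show ?thesis using isometric[of "g [^] m" x "\<phi> g x"] g x by (simp add: orb_def D_def)
  qed
  have D2: "d (orb m) (orb (m + 2)) = d x (\<phi> g (\<phi> g x))" for m
  proof -
    have "g [^] (m + 2) = g [^] m \<otimes> (g \<otimes> g)"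
      using g int_pow_mult[of g m 2] int_pow_mult[of g 1 1] by simp
    then have "orb (m + 2) = \<phi> (g [^] m) (\<phi> g (\<phi> g x))"
      using g x by (simp add: orb_def act_mult)
    then show ?thesis using isometric[of "g [^] m" x "\<phi> g (\<phi> g x)"] g x by (simp add: orb_def)
  qed
  \<comment> \<open>The slack 1/2 avoids the question whether the infimum over the orbit is attained.\<close>
  obtain m where m: "\<And>n. d y (orb m) \<le> d y (orb n) + 1 / 2"
    using int_approx_minimum[of "\<lambda>n. d y (orb n)" "1/2"] by auto
  have D2': "d (orb (m - 1)) (orb (m + 1)) = d x (\<phi> g (\<phi> g x))"
    using D2[of "m - 1"] by (simp add: add.commute)
  have "d y (orb m) + d (orb (m - 1)) (orb (m + 1))
      \<le> max (d y (orb (m - 1)) + d (orb m) (orb (m + 1))) (d y (orb (m + 1)) + d (orb m) (orb (m - 1))) + 2 * \<delta>"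
    using y oX by (intro four_point)
  then have 1: "d y (orb m) + 2 * \<delta> + 1 < max (d y (orb (m - 1))) (d y (orb (m + 1)))"
    using far D1[of m] D1[of "m - 1"] D2'
    by (auto simp: D_def mdist_commute max_def split: if_splits)
  have 2: "d (\<phi> g y) (orb (n + 1)) = d y (orb n)" for n
    using isometric[OF g y(1) oX[of n]] by (simp add: shift)
  have "d y (orb (m + 1)) + d (\<phi> g y) (orb m)
      \<le> max (d y (\<phi> g y) + d (orb (m + 1)) (orb m)) (d y (orb m) + d (orb (m + 1)) (\<phi> g y)) + 2 * \<delta>"
    using y g oX by (intro four_point) auto
  then have "d y (orb (m + 1)) + d y (orb (m - 1)) \<le> max (C + D) (2 * d y (orb m)) + 2 * \<delta>"
    using 2[of m] 2[of "m - 1"] D1[of m] y(2) by (auto simp: mdist_commute)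
  then have "2 * d y (orb m) \<le> C + D"
    using 1 m[of "m - 1"] m[of "m + 1"] delta_nonneg by (auto simp: max_def split: if_splits)
  then show ?thesis unfolding D_def orb_def by (intro exI[of _ m]) simp
qed

end

section \<open>Fixed points on the ideal boundary\<close>

context hyperbolic_action
begin

abbreviation bd where "bd \<equiv> boundary_action M \<phi>"

lemma group_action_bd: "group_action G (ideal_boundary M) bd"
  by (rule group_action_boundary_action[OF group_action_axioms]) (rule isometric)

lemma bd_eq_iff:
  assumes h: "h \<in> carrier G" and \<xi>: "\<xi> \<in> ideal_boundary M" and u: "u \<in> \<xi>"
  shows "bd h \<xi> = \<xi> \<longleftrightarrow> gromov_asymptotic M (\<phi> h \<circ> u) u"
proof -
  interpret B: group_action G "ideal_boundary M" bd by (rule group_action_bd)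
  have mem: "\<phi> h \<circ> u \<in> bd h \<xi>" using \<xi> u by (simp add: boundary_action_def)
  have bdh: "bd h \<xi> \<in> ideal_boundary M" by (rule B.element_image[OF h \<xi> refl])
  show ?thesis
    using ideal_boundary_eqI[OF bdh \<xi> mem u] ideal_boundary_asymptotic[OF \<xi> _ u] mem by auto
qed

text \<open>Here \<open>u\<close> stands for a point close to a fixed point of \<open>h\<close> at infinity. If \<open>h\<close> carries \<open>p\<close>
  towards it, then \<open>h\<close> carries \<open>h p\<close> equally far towards \<open>h u\<close>, and the direction from \<open>h p\<close>
  to \<open>h u\<close> is the same as that to \<open>u\<close>.\<close>

lemma towards_fixed_point_doubles:
  assumes h: "h \<in> carrier G" and p: "p \<in> X" and u: "u \<in> X"
    and near: "d p (\<phi> h p) + \<delta> < gromov_product M (\<phi> h p) (\<phi> h u) u"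
    and toward: "d p (\<phi> h p) - \<kappa> \<le> d p u - d (\<phi> h p) u"
  shows "2 * d p (\<phi> h p) - 2 * \<kappa> - 2 * \<delta> \<le> d p (\<phi> h (\<phi> h p))"
proof -
  let ?q = "\<phi> h p" and ?r = "\<phi> h (\<phi> h p)"
  have in_X: "?q \<in> X" "?r \<in> X" "\<phi> h u \<in> X" using h p u by auto
  have d1: "d ?q ?r = d p ?q" "d ?q (\<phi> h u) = d p u" "d ?r (\<phi> h u) = d ?q u"
    using isometric[OF h p in_X(1)] isometric[OF h p u] isometric[OF h in_X(1) u] by auto
  have fp: "d ?q (\<phi> h u) + d ?r u \<le> max (d ?q ?r + d (\<phi> h u) u) (d ?q u + d (\<phi> h u) ?r) + 2 * \<delta>"
    using in_X u by (intro four_point)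
  have tri: "d ?q u \<le> d ?q ?r + d ?r u" "d p u \<le> d p ?r + d ?r u"
    using in_X p u mdist_triangle by metis+
  have "d p ?q - \<kappa> - 2 * \<delta> \<le> d ?q u - d ?r u"
    using fp tri(1) near d1 toward
    by (auto simp: gromov_product_def max_def mdist_commute field_simps split: if_splits)
  then show ?thesis using toward tri(2) by linarith
qed

text \<open>The point \<open>p\<close> and its images under the elements \<open>h\<close> that fix \<open>\<xi>\<close> and \<open>\<eta>\<close> all lie within \<open>K\<close>
  of a line between the two points. So \<open>h\<close> moves \<open>p\<close> almost straight towards one of them, and
  then \<open>h\<^sup>2\<close> moves it nearly twice as far. That contradicts backtracking as soon as the
  displacement is large.\<close>

lemma backtracks_imp_bounded_displacement:
  assumes "\<xi> \<in> ideal_boundary M" "\<eta> \<in> ideal_boundary M" "\<xi> \<noteq> \<eta>" and p: "p \<in> X"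
  obtains R where "\<And>h. \<lbrakk>h \<in> carrier G; bd h \<xi> = \<xi>; bd h \<eta> = \<eta>; backtracks c h\<rbrakk> \<Longrightarrow> d p (\<phi> h p) \<le> R"
proof -
  obtain u v where uv: "u \<in> \<xi>" "v \<in> \<eta>" using assms ideal_boundary_nonempty by meson
  have ran: "range u \<subseteq> X" "range v \<subseteq> X" using assms uv ideal_boundary_range by auto
  have X1: "u i \<in> X" "v i \<in> X" for i using ran by auto
  have "\<not> gromov_asymptotic M u v" using ideal_boundary_eqI[OF assms(1,2) uv] assms(3) by blast
  from not_asymptotic_bounded[OF p ran this] obtain K where
    K: "\<And>u' v'. \<lbrakk>range u' \<subseteq> X; range v' \<subseteq> X; gromov_asymptotic M u' u; gromov_asymptotic M v' v\<rbrakk> \<Longrightarrow>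
      \<exists>N. \<forall>i\<ge>N. \<forall>j\<ge>N. gromov_product M p (u' i) (v' j) \<le> K" by blast
  interpret B: group_action G "ideal_boundary M" bd by (rule group_action_bd)
  have "d p (\<phi> h p) \<le> 4 * K + 6 * \<delta> + c"
    if h: "h \<in> carrier G" "bd h \<xi> = \<xi>" "bd h \<eta> = \<eta>" and bt: "backtracks c h" for h
  proof -
    let ?q = "\<phi> h p"
    have q: "?q \<in> X" using h p by simp
    have asym: "gromov_asymptotic M (\<phi> h \<circ> u) u" "gromov_asymptotic M (\<phi> h \<circ> v) v"
      using bd_eq_iff[OF h(1) assms(1) uv(1)] bd_eq_iff[OF h(1) assms(2) uv(2)] h by auto
    have inv: "inv h \<in> carrier G" "bd (inv h) \<xi> = \<xi>" "bd (inv h) \<eta> = \<eta>"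
      using h B.orbit_sym_aux[OF h(1) assms(1)] B.orbit_sym_aux[OF h(1) assms(2)] by auto
    have asym': "gromov_asymptotic M (\<phi> (inv h) \<circ> u) u" "gromov_asymptotic M (\<phi> (inv h) \<circ> v) v"
      using bd_eq_iff[OF inv(1) assms(1) uv(1)] bd_eq_iff[OF inv(1) assms(2) uv(2)] inv by auto
    have ranh: "range (\<phi> h \<circ> u) \<subseteq> X" "range (\<phi> h \<circ> v) \<subseteq> X"
        "range (\<phi> (inv h) \<circ> u) \<subseteq> X" "range (\<phi> (inv h) \<circ> v) \<subseteq> X"
      using ran h(1) inv(1) by (auto simp: image_subset_iff)
    let ?L = "d p ?q + \<delta> + 1"
    obtain N1 where N1: "\<And>i j. \<lbrakk>i \<ge> N1; j \<ge> N1\<rbrakk> \<Longrightarrow> gromov_product M p (u i) (v j) \<le> K"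
      using K[OF ran] ideal_boundary_asymptotic[OF assms(1) uv(1,1)]
        ideal_boundary_asymptotic[OF assms(2) uv(2,2)] by blast
    obtain N2 where N2: "\<And>i j. \<lbrakk>i \<ge> N2; j \<ge> N2\<rbrakk> \<Longrightarrow>
        gromov_product M p (\<phi> (inv h) (u i)) (\<phi> (inv h) (v j)) \<le> K"
      using K[OF ranh(3,4) asym'] by auto
    obtain N3 where N3: "\<And>i j. \<lbrakk>i \<ge> N3; j \<ge> N3\<rbrakk> \<Longrightarrow> ?L \<le> gromov_product M ?q (\<phi> h (u i)) (u j)"
      using asym(1)[unfolded gromov_asymptotic_iff[OF q ranh(1) ran(1)], THEN spec[of _ ?L]] by auto
    obtain N4 where N4: "\<And>i j. \<lbrakk>i \<ge> N4; j \<ge> N4\<rbrakk> \<Longrightarrow> ?L \<le> gromov_product M ?q (\<phi> h (v i)) (v j)"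
      using asym(2)[unfolded gromov_asymptotic_iff[OF q ranh(2) ran(2)], THEN spec[of _ ?L]] by auto
    define n where "n = Max {N1, N2, N3, N4}"
    have n: "n \<ge> N1" "n \<ge> N2" "n \<ge> N3" "n \<ge> N4" by (auto simp: n_def)
    have e1: "d p (u n) + d p (v n) \<le> d (u n) (v n) + 2 * K"
      using N1[OF n(1,1)] by (simp add: gromov_product_def mdist_commute)
    have e2: "d ?q (u n) + d ?q (v n) \<le> d (u n) (v n) + 2 * K"
    proof -
      have "d (\<phi> (inv h) w) p = d ?q w" if "w \<in> X" for w
        using dist_act_left[OF inv(1) that p] h by (simp add: mdist_commute)
      moreover have "d (\<phi> (inv h) (u n)) (\<phi> (inv h) (v n)) = d (u n) (v n)"
        using isometric[OF inv(1) X1] .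
      ultimately show ?thesis
        using N2[OF n(2,2)] X1 by (simp add: gromov_product_def mdist_commute)
    qed
    have "d p ?q + d (u n) (v n) \<le> max (d p (u n) + d ?q (v n)) (d p (v n) + d ?q (u n)) + 2 * \<delta>"
      using p q X1 by (intro four_point)
    then consider "d p ?q - (2 * K + 2 * \<delta>) \<le> d p (u n) - d ?q (u n)"
      | "d p ?q - (2 * K + 2 * \<delta>) \<le> d p (v n) - d ?q (v n)"
      using e2 by (auto simp: max_def split: if_splits)
    then have "2 * d p ?q - 2 * (2 * K + 2 * \<delta>) - 2 * \<delta> \<le> d p (\<phi> h ?q)"
    proof cases
      case 1
      show ?thesis
        by (rule towards_fixed_point_doubles[OF h(1) p X1(1)[of n] _ 1]) (use N3[OF n(3,3)] in simp)
    next
      case 2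
      show ?thesis
        by (rule towards_fixed_point_doubles[OF h(1) p X1(2)[of n] _ 2]) (use N4[OF n(4,4)] in simp)
    qed
    then show ?thesis using backtracksD[OF bt p] by simp
  qed
  then show thesis by (rule that)
qed

text \<open>The powers of a loxodromic element fix its two fixed points, so the previous lemma bounds
  their displacement at a point. The action being proper, only finitely many powers are
  distinct.\<close>

lemma not_loxodromic_if_backtracks:
  assumes g: "g \<in> carrier G" and X: "X \<noteq> {}" and bt: "\<And>n::nat. backtracks c (g [^] n)"
  shows "\<not> loxodromic G (boundary_topology M) bd g"
proof
  assume lox: "loxodromic G (boundary_topology M) bd g"
  then have inf_ord: "ord g = 0" and "card (invariants (ideal_boundary M) bd g) = 2"
    by (auto simp: loxodromic_def)
  then obtain \<xi> \<eta> where "invariants (ideal_boundary M) bd g = {\<xi>, \<eta>}" and ne: "\<xi> \<noteq> \<eta>"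
    by (auto simp: card_2_iff)
  then have \<xi>: "\<xi> \<in> ideal_boundary M" "bd g \<xi> = \<xi>" and \<eta>: "\<eta> \<in> ideal_boundary M" "bd g \<eta> = \<eta>"
    by (auto simp: invariants_def)
  interpret B: group_action G "ideal_boundary M" bd by (rule group_action_bd)
  have stab: "g [^] n \<in> stabilizer G bd \<zeta>"
    if "\<zeta> \<in> ideal_boundary M" "bd g \<zeta> = \<zeta>" for n :: nat and \<zeta>
  proof (induction n)
    case 0
    show ?case using B.stabilizer_one_closed[OF that(1)] by simp
  next
    case (Suc n)
    have "g \<in> stabilizer G bd \<zeta>" using g that by (simp add: stabilizer_def)
    with Suc show ?case using B.stabilizer_m_closed[OF that(1)] by simp
  qed
  obtain p where p: "p \<in> X" using X by blast
  obtain R where R: "\<And>h. \<lbrakk>h \<in> carrier G; bd h \<xi> = \<xi>; bd h \<eta> = \<eta>; backtracks c h\<rbrakk> \<Longrightarrow> d p (\<phi> h p) \<le> R"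
    using backtracks_imp_bounded_displacement[OF \<xi>(1) \<eta>(1) ne p] by blast
  have "range (\<lambda>n::nat. g [^] n) \<subseteq> {h \<in> carrier G. d p (\<phi> h p) \<le> R}"
    using R bt stab \<xi> \<eta> g by (auto simp: stabilizer_def)
  then have "\<not> inj (\<lambda>n::nat. g [^] n)"
    using finite_displacement[OF p] finite_subset finite_imageD infinite_UNIV_nat by metis
  then obtain i j :: nat where "g [^] i = g [^] j" "i \<noteq> j" by (auto simp: inj_def)
  then show False using pow_eq_div2[OF g] pow_eq_id[OF g] inf_ord
    by (metis dvd_0_left_iff linorder_neqE_nat zero_less_diff less_numeral_extra(3))
qed

text \<open>Sequential compactness of the space together with its ideal boundary. For each \<open>k\<close>, the
  points at distance \<open>k\<close> on the way from \<open>p\<close> to \<open>z n\<close> stay in a compact ball. Along a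
  subsequence they are within 1 of each other, and then the Gromov products of the
  corresponding \<open>z n\<close> are at least about \<open>k\<close>. A diagonal subsequence serves all \<open>k\<close>.\<close>

lemma gromov_subsequence:
  assumes z: "\<And>n. z n \<in> X" and p: "p \<in> X" and lim: "\<And>R. \<exists>N. \<forall>n\<ge>N. R < d p (z n)"
  obtains r :: "nat \<Rightarrow> nat" where "strict_mono r" "gromov_asymptotic M (z \<circ> r) (z \<circ> r)"
proof -
  let ?gp = "gromov_product M p"
  define P where "P = (\<lambda>k (s :: nat \<Rightarrow> nat). \<forall>i j. real k - 1 / 2 - 2 * \<delta> \<le> ?gp (z (s i)) (z (s j)))"
  have P_iff: "P k s \<longleftrightarrow> (\<forall>i j. real k - 1 / 2 - 2 * \<delta> \<le> ?gp (z (s i)) (z (s j)))" for k s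
    by (simp add: P_def)
  interpret subseqs P
  proof
    fix k and s :: "nat \<Rightarrow> nat" assume s: "strict_mono s"
    obtain N where N: "\<And>n. n \<ge> N \<Longrightarrow> real k < d p (z n)" using lim by blast
    have "\<exists>y\<in>X. d p y = real k \<and> d y (z (s (n + N))) \<le> d p (z (s (n + N))) - real k + 1" for n
      using rough_geodesic[OF p z, of "real k" "s (n + N)"] N[of "s (n + N)"] seq_suble[OF s, of "n + N"]
      by force
    then obtain y where y: "\<And>n. y n \<in> X" "\<And>n. d p (y n) = real k"
      "\<And>n. d (y n) (z (s (n + N))) \<le> d p (z (s (n + N))) - real k + 1"
      by metis
    interpret MS: Metric_space X d by simp
    have "compactin (mtopology_of M) (mcball_of M p (real k))"
      using proper p by (simp add: proper_metric_space_def)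
    moreover have "range y \<subseteq> mcball_of M p (real k)" using y p by auto
    ultimately obtain l r where l: "strict_mono r" "limitin (mtopology_of M) (y \<circ> r) l sequentially"
      unfolding mtopology_of_def MS.compactin_sequentially by blast
    then obtain N' where N': "\<And>n. n \<ge> N' \<Longrightarrow> d (y (r n)) l < 1 / 2" and lX: "l \<in> X"
      unfolding mtopology_of_def MS.limitin_metric eventually_sequentially by (metis comp_apply half_gt_zero_iff zero_less_one)
    define r' where "r' = (\<lambda>n. r (n + N') + N)"
    have r': "strict_mono r'" using l(1) by (auto simp: r'_def strict_mono_def)
    have "real k - 1 / 2 - 2 * \<delta> \<le> ?gp (z (s (r' i))) (z (s (r' j)))" for i j
    proof -
      let ?i = "r (i + N')" and ?j = "r (j + N')"
      have "d (y ?i) (y ?j) \<le> 1"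
        using N'[of "i + N'"] N'[of "j + N'"] mdist_triangle[OF y(1)[of ?i] lX y(1)[of ?j]]
        by (simp add: mdist_commute)
      then have "real k - 1 / 2 \<le> ?gp (y ?i) (y ?j)"
        using y(2) by (simp add: gromov_product_def mdist_commute)
      moreover have "real k - 1 / 2 \<le> ?gp (z (s (r' i))) (y ?i)" "real k - 1 / 2 \<le> ?gp (y ?j) (z (s (r' j)))"
        using y(2,3)[of ?i] y(2,3)[of ?j] by (auto simp: r'_def gromov_product_def mdist_commute)
      moreover have "min (?gp (z (s (r' i))) (y ?i)) (?gp (y ?i) (z (s (r' j)))) - \<delta> \<le> ?gp (z (s (r' i))) (z (s (r' j)))"
        "min (?gp (y ?i) (y ?j)) (?gp (y ?j) (z (s (r' j)))) - \<delta> \<le> ?gp (y ?i) (z (s (r' j)))"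
        using p z y(1) gromov_product_min by auto
      ultimately show ?thesis using delta_nonneg by (auto simp: min_def split: if_splits)
    qed
    with r' show "\<exists>r'. strict_mono r' \<and> P k (s \<circ> r')" by (auto simp: P_def)
  qed
  have P: "P k (diagseq \<circ> ((+) (Suc k)))" for k
    by (rule diagseq_holds) (auto simp: P_iff)
  have ran: "range (z \<circ> diagseq) \<subseteq> X" using z by auto
  have "gromov_asymptotic M (z \<circ> diagseq) (z \<circ> diagseq)"
    unfolding gromov_asymptotic_iff[OF p ran ran]
  proof
    fix K
    obtain k :: nat where k: "K + 1 / 2 + 2 * \<delta> \<le> real k" using real_arch_simple by blast
    have "K \<le> ?gp ((z \<circ> diagseq) i) ((z \<circ> diagseq) j)" if "i \<ge> Suc k" "j \<ge> Suc k" for i j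
      using P_iff[THEN iffD1, OF P[of k], rule_format, of "i - Suc k" "j - Suc k"] that k by simp
    then show "\<exists>N. \<forall>i\<ge>N. \<forall>j\<ge>N. K \<le> ?gp ((z \<circ> diagseq) i) ((z \<circ> diagseq) j)" by blast
  qed
  with subseq_diagseq show thesis by (rule that)
qed

text \<open>Exhaust \<open>G\<close> by the finite sets \<open>S n\<close> of elements with displacement at most \<open>n\<close> at \<open>p\<close>, and
  let \<open>z n\<close> be an almost fixed point of \<open>S n\<close>. If \<open>z n\<close> stayed bounded for infinitely many
  \<open>n\<close>, then all of \<open>G\<close> would have bounded displacement at \<open>p\<close> and be finite. Otherwise \<open>z n\<close>
  accumulates at a boundary point, which every \<open>g\<close> fixes since \<open>g\<close> moves almost all \<open>z n\<close> by a
  bounded amount.\<close>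

lemma all_backtrack_imp_fixed_boundary_point:
  assumes inf: "infinite (carrier G)" and X: "X \<noteq> {}" and c: "0 \<le> c"
    and bt: "\<And>g. g \<in> carrier G \<Longrightarrow> backtracks c g"
  obtains \<xi> where "\<xi> \<in> ideal_boundary M" "\<And>g. g \<in> carrier G \<Longrightarrow> bd g \<xi> = \<xi>"
proof -
  obtain p where p: "p \<in> X" using X by blast
  define S where "S = (\<lambda>n::nat. {g \<in> carrier G. d p (\<phi> g p) \<le> real n})"
  let ?K = "9 + 18 * \<delta> + c"
  have "\<exists>x\<in>X. \<forall>s\<in>S n. d x (\<phi> s x) \<le> ?K" for n
    by (rule almost_fixed_point)
      (use finite_displacement[OF p] X c bt in \<open>auto simp: S_def\<close>)
  then obtain z where z: "\<And>n. z n \<in> X" "\<And>n s. s \<in> S n \<Longrightarrow> d (z n) (\<phi> s (z n)) \<le> ?K" by metis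
  have "\<exists>N. \<forall>n\<ge>N. R < d p (z n)" for R
  proof (rule ccontr)
    assume "\<not> ?thesis"
    then have freq: "\<And>N. \<exists>n\<ge>N. d p (z n) \<le> R" by (auto simp: not_less)
    have "d p (\<phi> g p) \<le> 2 * R + ?K" if g: "g \<in> carrier G" for g
    proof -
      obtain N :: nat where N: "d p (\<phi> g p) \<le> real N" using real_arch_simple by blast
      obtain n where n: "n \<ge> N" "d p (z n) \<le> R" using freq by blast
      have "g \<in> S n" using g N n(1) by (simp add: S_def)
      then have "d (z n) (\<phi> g (z n)) \<le> ?K" by (rule z(2))
      moreover have "d (\<phi> g (z n)) (\<phi> g p) \<le> R"
        using isometric[OF g z(1) p] n(2) by (simp add: mdist_commute)
      moreover have "d p (\<phi> g p) \<le> d p (z n) + (d (z n) (\<phi> g (z n)) + d (\<phi> g (z n)) (\<phi> g p))"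
        using mdist_triangle[of p M "z n" "\<phi> g p"] mdist_triangle[of "z n" M "\<phi> g (z n)" "\<phi> g p"] p z(1)[of n] g
        by force
      ultimately show ?thesis using n(2) by simp
    qed
    then have "carrier G = {g \<in> carrier G. d p (\<phi> g p) \<le> 2 * R + ?K}" by blast
    then show False using finite_displacement[OF p] inf by metis
  qed
  then obtain r where r: "strict_mono r" "gromov_asymptotic M (z \<circ> r) (z \<circ> r)"
    using gromov_subsequence[of z p] z(1) p by blast
  define u where "u = z \<circ> r"
  have ranu: "range u \<subseteq> X" using z(1) by (auto simp: u_def)
  have u: "u \<in> gromov_sequences M" using r ranu by (simp add: gromov_sequences_def u_def)
  define \<xi> where "\<xi> = asymptotic_rel `` {u}"
  have \<xi>: "\<xi> \<in> ideal_boundary M" unfolding \<xi>_def ideal_boundary_def by (rule quotientI[OF u])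
  have u\<xi>: "u \<in> \<xi>" unfolding \<xi>_def by (rule equiv_class_self[OF equiv_asymptotic u])
  have "bd g \<xi> = \<xi>" if g: "g \<in> carrier G" for g
    unfolding bd_eq_iff[OF g \<xi> u\<xi>]
  proof -
    have rang: "range (\<phi> g \<circ> u) \<subseteq> X" using ranu g by (auto simp: image_subset_iff)
    obtain N0 :: nat where N0: "d p (\<phi> g p) \<le> real N0" using real_arch_simple by blast
    show "gromov_asymptotic M (\<phi> g \<circ> u) u"
      unfolding gromov_asymptotic_iff[OF p rang ranu]
    proof
      fix K
      obtain N where N: "\<And>i j. \<lbrakk>i \<ge> N; j \<ge> N\<rbrakk> \<Longrightarrow> K + ?K \<le> gromov_product M p (u i) (u j)"
        using r(2)[folded u_def, unfolded gromov_asymptotic_iff[OF p ranu ranu]] by blast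
      have "K \<le> gromov_product M p ((\<phi> g \<circ> u) i) (u j)" if "i \<ge> max N N0" "j \<ge> max N N0" for i j
      proof -
        have "g \<in> S (r i)" using g N0 that seq_suble[OF r(1), of i] by (simp add: S_def)
        then have *: "d (u i) (\<phi> g (u i)) \<le> ?K" using z(2) by (simp add: u_def)
        have "u i \<in> X" "u j \<in> X" "\<phi> g (u i) \<in> X" using ranu g by (auto simp: image_subset_iff)
        then have "d (u i) p \<le> d (u i) (\<phi> g (u i)) + d (\<phi> g (u i)) p"
          "d (\<phi> g (u i)) (u j) \<le> d (u i) (\<phi> g (u i)) + d (u i) (u j)"
          using p mdist_triangle mdist_commute by metis+
        then show ?thesis using * N[of i j] that by (simp add: gromov_product_def)
      qed
      then show "\<exists>N. \<forall>i\<ge>N. \<forall>j\<ge>N. K \<le> gromov_product M p ((\<phi> g \<circ> u) i) (u j)" by blast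
    qed
  qed
  with \<xi> show thesis by (rule that)
qed

lemma exists_not_backtracking:
  assumes inf: "infinite (carrier G)" and X: "X \<noteq> {}" and c: "0 \<le> c"
    and not_par: "\<not> maximal_parabolic_subgroup G (boundary_topology M) bd (carrier G)"
  shows "\<exists>g\<in>carrier G. \<not> backtracks c g"
proof (rule ccontr)
  assume "\<not> ?thesis"
  then have bt: "\<And>g. g \<in> carrier G \<Longrightarrow> backtracks c g" by blast
  obtain \<xi> where \<xi>: "\<xi> \<in> ideal_boundary M" "\<And>g. g \<in> carrier G \<Longrightarrow> bd g \<xi> = \<xi>"
    using all_backtrack_imp_fixed_boundary_point[OF inf X c bt] by blast
  have "\<not> loxodromic G (boundary_topology M) bd g" if "g \<in> carrier G" for g
    using not_loxodromic_if_backtracks[OF that X, of c] bt that by simp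
  then have "parabolic_fixing G (boundary_topology M) bd (carrier G) \<xi>"
    using \<xi> inf subgroup_self by (auto simp: parabolic_fixing_def stabilizer_def)
  moreover have "Q = carrier G"
    if "parabolic_subgroup G (boundary_topology M) bd Q" "carrier G \<subseteq> Q" for Q
    using that subgroup.subset by (auto simp: parabolic_subgroup_def parabolic_fixing_def)
  ultimately show False
    using not_par by (auto simp: maximal_parabolic_subgroup_def parabolic_subgroup_def)
qed

end

section \<open>Powers of pointwise inner automorphisms\<close>

context hyperbolic_action
begin

text \<open>The values of \<open>\<alpha>\<^sup>n\<close> on a finite set have almost fixed points \<open>x n\<close>, with a bound independent
  of \<open>n\<close>. The element \<open>g\<close> serves to move \<open>x n\<close> into a fixed ball: \<open>\<alpha>\<^sup>n(g)\<close> is a conjugate \<open>h g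
  h\<inverse>\<close> that moves \<open>x n\<close> little, and the points moved little by \<open>g\<close> are near an orbit of its
  powers. The pigeonhole principle applies to the resulting conjugates of \<open>\<alpha>\<^sup>n\<close>, restricted to
  the generators.\<close>

lemma pointwise_inner_imp_inner_power:
  assumes S: "finite S" "S \<subseteq> carrier G" "generate G S = carrier G"
    and g: "g \<in> carrier G" "\<not> backtracks (4 * \<delta> + 1) g"
    and \<alpha>: "\<alpha> \<in> auto G" "\<And>x. x \<in> carrier G \<Longrightarrow> conjugate_in G x (\<alpha> x)"
  shows "\<exists>n>0. \<alpha> [^]\<^bsub>AutoGroup G\<^esub> (n::nat) \<in> Inn G"
proof -
  interpret A: group "AutoGroup G" by (rule AutoGroup)
  obtain p where p: "p \<in> X" and far: "d p (\<phi> g p) + 4 * \<delta> + 1 < d p (\<phi> g (\<phi> g p))"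
    using g(2) by (auto simp: backtracks_def not_le)
  define f where "f = (\<lambda>n::nat. \<alpha> [^]\<^bsub>AutoGroup G\<^esub> n)"
  have f_auto: "f n \<in> auto G" for n
    using A.nat_pow_closed[of \<alpha> n] \<alpha>(1) by (simp add: f_def carrier_AutoGroup)
  have f_closed [simp]: "f n x \<in> carrier G" if "x \<in> carrier G" for n x
    using auto_closed[OF f_auto that] .
  have f_mult: "f n (x \<otimes> y) = f n x \<otimes> f n y" if "x \<in> carrier G" "y \<in> carrier G" for n x y
    using f_auto[of n] that by (auto simp: auto_def hom_def)
  have f_add: "f (m + n) x = f m (f n x)" if "x \<in> carrier G" for m n x
  proof -
    have "f (m + n) = f m \<otimes>\<^bsub>AutoGroup G\<^esub> f n"
      using A.nat_pow_mult[of \<alpha> m n] \<alpha>(1) by (simp add: f_def carrier_AutoGroup)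
    then show ?thesis using mult_AutoGroup[OF f_auto f_auto] that by (simp add: compose_eq)
  qed
  have f_conj: "conjugate_in G x (f n x)" if "x \<in> carrier G" for n x
  proof (induction n)
    case 0
    show ?case using that conjugate_in_refl by (simp add: f_def AutoGroup_def BijGroup_def)
  next
    case (Suc n)
    have "f (Suc n) x = f 1 (f n x)" using f_add[OF that, of 1 n] by simp
    also have "f 1 = \<alpha>" using \<alpha>(1) by (simp add: f_def carrier_AutoGroup)
    finally show ?case
      using conjugate_in_trans[OF Suc \<alpha>(2)[OF f_closed[OF that]] that] by simp
  qed
  define S' where "S' = insert g S"
  have S': "finite S'" "S' \<subseteq> carrier G" using S g by (auto simp: S'_def)
  define T where "T = S' \<union> (\<lambda>(s, t). s \<otimes> t) ` (S' \<times> S')"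
  have T: "finite T" "T \<subseteq> carrier G" using S' by (auto simp: T_def)
  have "finite ((\<lambda>s. d p (\<phi> s p)) ` T)" using T by blast
  then obtain L0 where L0: "\<And>s. s \<in> T \<Longrightarrow> d p (\<phi> s p) \<le> L0"
    using bdd_above_finite unfolding bdd_above_def by (metis imageI)
  \<comment> \<open>The elements of \<open>\<alpha>\<^sup>n(T)\<close> are conjugate to those of \<open>T\<close>, so one constant serves for all \<open>n\<close>.\<close>
  define c where "c = max L0 0 + 2 * \<delta>"
  have c: "0 \<le> c" using delta_nonneg by (simp add: c_def)
  have bt: "backtracks c (f n s)" if s: "s \<in> T" for n s
  proof -
    have sG: "s \<in> carrier G" using s T by blast
    obtain h where h: "h \<in> carrier G" "f n s = h \<otimes> s \<otimes> inv h"
      using f_conj[OF sG] by (auto simp: conjugate_in_def)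
    have "d (\<phi> h p) (\<phi> (f n s) (\<phi> h p)) = d p (\<phi> s p)"
      using isometric[OF h(1) p, of "\<phi> s p"] h sG p by (simp add: act_mult)
    then show ?thesis
      unfolding c_def
      using small_displacement_imp_backtracks[of "f n s" "\<phi> h p" "max L0 0"] sG h(1) p L0[OF s] by simp
  qed
  let ?K = "9 + 18 * \<delta> + c"
  have "\<exists>x\<in>X. \<forall>s\<in>f n ` S'. d x (\<phi> s x) \<le> ?K" for n
  proof (rule almost_fixed_point[OF _ _ _ c])
    fix s t assume "s \<in> f n ` S'" "t \<in> f n ` S'"
    then obtain s' t' where "s' \<in> S'" "t' \<in> S'" "s = f n s'" "t = f n t'" by blast
    moreover from this have "s \<otimes> t = f n (s' \<otimes> t')" using S'(2) by (simp add: f_mult subset_iff)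
    moreover from calculation have "s' \<otimes> t' \<in> T" by (force simp: T_def)
    ultimately show "backtracks c (s \<otimes> t)" using bt by simp
  qed (use S' p bt in \<open>auto simp: T_def\<close>)
  then obtain x where x: "\<And>n. x n \<in> X" "\<And>n s. s \<in> S' \<Longrightarrow> d (x n) (\<phi> (f n s) (x n)) \<le> ?K"
    by (metis imageI)
  define R where "R = (?K + d p (\<phi> g p)) / 2"
  define W where "W = {w \<in> carrier G. d p (\<phi> w p) \<le> 2 * R + ?K}"
  have "\<exists>u\<in>carrier G. \<forall>s\<in>S'. u \<otimes> f n s \<otimes> inv u \<in> W" for n
  proof -
    obtain h where h: "h \<in> carrier G" "f n g = h \<otimes> g \<otimes> inv h"
      using f_conj[OF g(1)] by (auto simp: conjugate_in_def)
    define y where "y = \<phi> (inv h) (x n)"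
    have y: "y \<in> X" "\<phi> h y = x n" using h(1) x(1) by (auto simp: y_def)
    have "d y (\<phi> g y) = d (x n) (\<phi> (f n g) (x n))"
      using isometric[OF h(1) y(1), of "\<phi> g y"] h g(1) y x(1) by (simp add: act_mult y_def)
    then have "d y (\<phi> g y) \<le> ?K" using x(2)[of g n] by (simp add: S'_def)
    from not_backtracks_near_orbit[OF g(1) p far y(1) this]
    obtain m :: int where m: "d y (\<phi> (g [^] m) p) \<le> R" by (auto simp: R_def)
    \<comment> \<open>The factor \<open>h\<inverse>\<close> turns \<open>\<alpha>\<^sup>n(g)\<close> into \<open>g\<close>, and the power of \<open>g\<close> brings the point back to \<open>p\<close>.\<close>
    define u where "u = inv (g [^] m) \<otimes> inv h"
    have u: "u \<in> carrier G" using g h by (simp add: u_def)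
    have ux: "d (\<phi> u (x n)) p \<le> R"
      using m dist_act_left[of "inv (g [^] m)" y p] g(1) h(1) p x(1) y(1) by (simp add: u_def act_mult y_def)
    have "u \<otimes> f n s \<otimes> inv u \<in> W" if s: "s \<in> S'" for s
    proof -
      have sG: "s \<in> carrier G" using s S' by blast
      let ?w = "u \<otimes> f n s \<otimes> inv u" and ?z = "\<phi> u (x n)"
      have w: "?w \<in> carrier G" and z: "?z \<in> X" using u sG x(1) by auto
      have "\<phi> ?w ?z = \<phi> u (\<phi> (f n s) (x n))" using u sG x(1) by (simp add: act_mult)
      then have "d ?z (\<phi> ?w ?z) \<le> ?K"
        using isometric[OF u x(1)[of n], of "\<phi> (f n s) (x n)"] x sG s by simp
      moreover have "d (\<phi> ?w ?z) (\<phi> ?w p) \<le> R" using isometric[OF w z p] ux by simp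
      moreover have "d p (\<phi> ?w p) \<le> d p ?z + (d ?z (\<phi> ?w ?z) + d (\<phi> ?w ?z) (\<phi> ?w p))"
        using mdist_triangle[OF p z, of "\<phi> ?w p"] mdist_triangle[OF z, of "\<phi> ?w ?z" "\<phi> ?w p"] w z p
        by (smt (verit) act_closed)
      ultimately show ?thesis using ux w by (simp add: W_def mdist_commute)
    qed
    with u show ?thesis by blast
  qed
  then obtain u where u: "\<And>n. u n \<in> carrier G" "\<And>n s. s \<in> S' \<Longrightarrow> u n \<otimes> f n s \<otimes> inv (u n) \<in> W"
    by metis
  define q where "q = (\<lambda>n x. u n \<otimes> f n x \<otimes> inv (u n))"
  have q_hom: "q n \<in> hom G G" for n
  proof (rule homI)
    fix x y assume xy: "x \<in> carrier G" "y \<in> carrier G"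
    have "inv (u n) \<otimes> (u n \<otimes> z) = z" if "z \<in> carrier G" for z
      using u(1)[of n] that by (simp flip: m_assoc)
    then show "q n (x \<otimes> y) = q n x \<otimes> q n y"
      using xy u(1)[of n] by (simp add: q_def f_mult m_assoc)
  qed (use u(1) in \<open>simp add: q_def\<close>)
  have "finite W" unfolding W_def by (rule finite_displacement[OF p])
  then have "finite (S' \<rightarrow>\<^sub>E W)" using S'(1) by (simp add: finite_PiE)
  moreover have "range (\<lambda>n. restrict (q n) S') \<subseteq> S' \<rightarrow>\<^sub>E W" using u(2) by (auto simp: q_def)
  ultimately have "\<not> inj (\<lambda>n. restrict (q n) S')"
    using finite_subset finite_imageD infinite_UNIV_nat by metis
  then obtain k l where kl: "k < l" "restrict (q k) S' = restrict (q l) S'"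
    by (metis (mono_tags, lifting) injI linorder_neqE_nat)
  have "q k s = q l s" if "s \<in> S" for s using kl(2) that by (metis S'_def insertCI restrict_apply')
  then have q_eq: "q k x = q l x" if "x \<in> carrier G" for x
    using hom_eq_on_generators[OF is_group is_group q_hom q_hom S(2)] S(3) that by blast
  define w where "w = inv (u l) \<otimes> u k"
  have w: "w \<in> carrier G" using u(1) by (simp add: w_def)
  have "f (l - k) = (\<lambda>x\<in>carrier G. w \<otimes> x \<otimes> inv w)"
  proof (rule extensionalityI[of _ "carrier G"])
    show "f (l - k) \<in> extensional (carrier G)" using f_auto by (auto simp: auto_def Bij_def)
    fix y assume "y \<in> carrier G"
    then obtain x where x: "x \<in> carrier G" "y = f k x"
      using f_auto[of k] by (auto simp: auto_def Bij_def bij_betw_def)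
    have "f l x = inv (u l) \<otimes> q l x \<otimes> u l"
    proof -
      have "inv (u l) \<otimes> (u l \<otimes> z) = z" if "z \<in> carrier G" for z
        using u(1)[of l] that by (simp flip: m_assoc)
      then show ?thesis using u(1)[of l] x(1) by (simp add: q_def m_assoc)
    qed
    also have "\<dots> = w \<otimes> y \<otimes> inv w"
    proof -
      have "q l x = u k \<otimes> y \<otimes> inv (u k)" using q_eq[OF x(1)] x(2) by (simp add: q_def)
      then show ?thesis
        using u(1) \<open>y \<in> carrier G\<close> by (simp add: w_def m_assoc inv_mult_group)
    qed
    finally have "f (l - k) y = w \<otimes> y \<otimes> inv w"
      using f_add[OF x(1), of "l - k" k] kl(1) x(2) by simp
    then show "f (l - k) y = (\<lambda>x\<in>carrier G. w \<otimes> x \<otimes> inv w) y"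
      using \<open>y \<in> carrier G\<close> by simp
  qed simp
  then have "f (l - k) \<in> Inn G" using w by (auto simp: Inn_def)
  then show ?thesis using kl(1) by (intro exI[of _ "l - k"]) (simp add: f_def)
qed

end

section \<open>Residual finiteness\<close>

lemma relatively_hyperbolic_imp_hyperbolic_action:
  assumes "relatively_hyperbolic TYPE('x) G \<G>"
  obtains M :: "'x metric" and \<delta> \<phi>
    where "hyperbolic_action M \<delta> G \<phi>" "mspace M \<noteq> {}"
      "\<G> = {P. maximal_parabolic_subgroup G (boundary_topology M) (boundary_action M \<phi>) P}"
proof -
  obtain M :: "'x metric" and \<phi> where M: "mspace M \<noteq> {}" "proper_metric_space M"
      "path_metric_space M" "gromov_hyperbolic M"
    and act: "properly_discontinuous_isometric_action G M \<phi>"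
    and \<G>: "\<G> = {P. maximal_parabolic_subgroup G (boundary_topology M) (boundary_action M \<phi>) P}"
    using assms unfolding relatively_hyperbolic_def by blast
  obtain \<delta> where \<delta>: "hyperbolic_space M \<delta>"
    using gromov_hyperbolic_imp_hyperbolic_space[OF M(4)] .
  have "hyperbolic_action_axioms M G \<phi>"
  proof
    fix x y and t :: real assume "x \<in> mspace M" "y \<in> mspace M" "0 \<le> t" "t \<le> mdist M x y"
    then show "\<exists>z\<in>mspace M. mdist M x z = t \<and> mdist M z y \<le> mdist M x y - t + 1"
      using path_metric_rough_geodesic[OF M(3)] by metis
  next
    fix x r assume x: "x \<in> mspace M"
    let ?B = "mcball_of M x r"
    have "{g \<in> carrier G. mdist M x (\<phi> g x) \<le> r} \<subseteq> {g \<in> carrier G. \<phi> g ` ?B \<inter> ?B \<noteq> {}}"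
    proof
      fix g assume g: "g \<in> {g \<in> carrier G. mdist M x (\<phi> g x) \<le> r}"
      interpret group_action G "mspace M" \<phi>
        using act by (simp add: properly_discontinuous_isometric_action_def)
      have "0 \<le> r" using g order_trans[OF mdist_nonneg, of M x "\<phi> g x" r] by blast
      moreover have "mdist M x x = 0" using x by simp
      ultimately have "mdist M x x \<le> r" by linarith
      then have "x \<in> ?B" "\<phi> g x \<in> ?B" using x g element_image[of g x] by simp_all
      with g show "g \<in> {g \<in> carrier G. \<phi> g ` ?B \<inter> ?B \<noteq> {}}" by blast
    qed
    moreover have "compactin (mtopology_of M) ?B" using M(2) x by (simp add: proper_metric_space_def)
    ultimately show "finite {g \<in> carrier G. mdist M x (\<phi> g x) \<le> r}"
      using act finite_subset unfolding properly_discontinuous_isometric_action_def by blast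
  qed (use act M(2) in \<open>auto simp: properly_discontinuous_isometric_action_def\<close>)
  then have "hyperbolic_action M \<delta> G \<phi>"
    using \<delta> act by (simp add: hyperbolic_action_def properly_discontinuous_isometric_action_def)
  then show thesis using M(1) \<G> by (rule that)
qed

theorem theorem1p1:
  fixes G :: "('g, 'm) monoid_scheme"
    and \<G> :: "'g set set"
    and H :: "('g \<Rightarrow> 'g) set set"
  assumes "group G"
    and "conjugacy_separable G"
    and "relatively_hyperbolic TYPE('x) G \<G>"
    and "\<And>P. P \<in> \<G> \<Longrightarrow> P \<subset> carrier G"
    and "subgroup H (Out G)"
    and "virtually_torsion_free ((Out G)\<lparr>carrier := H\<rparr>)"
  shows "residually_finite ((Out G)\<lparr>carrier := H\<rparr>)"
proof -
  interpret group G by (rule assms)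
  interpret O: group "Out G" by (rule group_Out)
  let ?H = "(Out G)\<lparr>carrier := H\<rparr>"
  interpret H: group ?H using subgroup.subgroup_is_group[OF assms(5) O.is_group] .
  have fg: "finitely_generated_subgroup G (carrier G)"
    using assms(3) by (simp add: relatively_hyperbolic_def)
  then obtain S where S: "finite S" "S \<subseteq> carrier G" "generate G S = carrier G"
    by (auto simp: finitely_generated_subgroup_def)
  obtain T where T: "torsion_free_subgroup ?H T" "finite (rcosets\<^bsub>?H\<^esub> T)"
    using assms(6) by (auto simp: virtually_torsion_free_def)
  have inner_power: "\<exists>n>0. \<alpha> [^]\<^bsub>AutoGroup G\<^esub> (n::nat) \<in> Inn G"
    if \<alpha>: "\<alpha> \<in> auto G" "\<And>x. x \<in> carrier G \<Longrightarrow> conjugate_in G x (\<alpha> x)" for \<alpha>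
  proof (cases "finite (carrier G)")
    case True
    interpret A: group "AutoGroup G" by (rule AutoGroup)
    have "auto G \<subseteq> carrier G \<rightarrow>\<^sub>E carrier G" by (auto simp: auto_def hom_def Bij_def extensional_def)
    then have "finite (carrier (AutoGroup G))"
      using True by (simp add: carrier_AutoGroup) (meson finite_PiE finite_subset)
    then have "\<alpha> [^]\<^bsub>AutoGroup G\<^esub> A.ord \<alpha> = \<one>\<^bsub>AutoGroup G\<^esub>" "0 < A.ord \<alpha>"
      using \<alpha>(1) A.pow_ord_eq_1[of \<alpha>] A.ord_ge_1[of \<alpha>] by (simp_all add: carrier_AutoGroup)
    moreover have "\<one>\<^bsub>AutoGroup G\<^esub> \<in> Inn G"
      using normal_imp_subgroup[OF Inn_normal] by (rule subgroup.one_closed)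
    ultimately show ?thesis by metis
  next
    case False
    obtain M :: "'x metric" and \<delta> \<phi> where M: "hyperbolic_action M \<delta> G \<phi>" "mspace M \<noteq> {}"
      "\<G> = {P. maximal_parabolic_subgroup G (boundary_topology M) (boundary_action M \<phi>) P}"
      using relatively_hyperbolic_imp_hyperbolic_action[OF assms(3)] .
    interpret hyperbolic_action M \<delta> G \<phi> by (rule M)
    have "\<not> maximal_parabolic_subgroup G (boundary_topology M) bd (carrier G)"
      using assms(4)[of "carrier G"] M(3) by blast
    then obtain g where "g \<in> carrier G" "\<not> backtracks (4 * \<delta> + 1) g"
      using exists_not_backtracking[OF False M(2), of "4 * \<delta> + 1"] delta_nonneg by auto
    then show ?thesis using pointwise_inner_imp_inner_power[OF S] \<alpha> by blast
  qed
  show ?thesis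
    unfolding residually_finite_def
  proof (intro ballI impI)
    fix c assume "c \<in> carrier ?H" and ne: "c \<noteq> \<one>\<^bsub>?H\<^esub>"
    then have c: "c \<in> carrier ?H" "c \<in> carrier (Out G)" using subgroup.subset[OF assms(5)] by auto
    interpret A: group "AutoGroup G" by (rule AutoGroup)
    interpret N: normal "Inn G" "AutoGroup G" by (rule Inn_normal)
    obtain \<alpha> where \<alpha>: "\<alpha> \<in> auto G" "\<alpha> \<in> c"
      using c(2) A.rcos_self[OF _ N.subgroup_axioms]
      by (auto simp: Out_def FactGroup_def RCOSETS_def carrier_AutoGroup)
    show "\<exists>(F :: nat monoid) f. group F \<and> finite (carrier F) \<and> f \<in> epi ?H F \<and> f c \<noteq> \<one>\<^bsub>F\<^esub>"
    proof (cases "\<forall>x\<in>carrier G. conjugate_in G x (\<alpha> x)")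
      case True
      then obtain n :: nat where n: "0 < n" "\<alpha> [^]\<^bsub>AutoGroup G\<^esub> n \<in> Inn G"
        using inner_power[OF \<alpha>(1)] by blast
      have "c [^]\<^bsub>?H\<^esub> n = \<one>\<^bsub>?H\<^esub>"
        using inner_power_imp_Out_torsion[OF c(2) \<alpha>(2) n(2)] O.nat_pow_consistent[of c n H] by simp
      then show ?thesis using H.torsion_element_detected[OF T c(1) ne _ n(1)] by blast
    next
      case False
      then obtain x where x: "x \<in> carrier G" "\<not> conjugate_in G x (\<alpha> x)" by blast
      obtain \<tau> :: "('g \<Rightarrow> 'g) set \<Rightarrow> ('g \<Rightarrow> nat) \<Rightarrow> ('g \<Rightarrow> nat) set"
        where \<tau>: "finite (\<tau> ` carrier (Out G))" "congruence_map (Out G) \<tau>" "\<tau> c \<noteq> \<tau> \<one>\<^bsub>Out G\<^esub>"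
        using Out_detects_class_change[OF assms(2) fg c(2) \<alpha>(2) x] by blast
      have "finite (\<tau> ` carrier ?H)"
        using \<tau>(1) by (rule finite_subset[rotated]) (use subgroup.subset[OF assms(5)] in auto)
      then show ?thesis
        using H.finite_image_of_congruence_map[OF _ congruence_map_subgroup[OF assms(5) \<tau>(2)] c(1)] \<tau>(3)
        by simp
    qed
  qed
qed

end
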